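(* Let $n>2$ be an integer and let $f:\mathbb{R}\to\mathbb{R}$ be a twice differentiable function. Let $M_f\subset\mathbb{C}^{n+1}$ be the real hypersurface defined by $$x_0=f(x_1)+\sum_{0<j<j+k\leq n}x_jx_kx_n^{n-j-k}.$$ Then $M_f$ is uniformly $2$-nondegenerate (that is, $2$-nondegenerate at every point), its Levi kernel is $1$-dimensional at every point, and at every point its Levi kernel adjoint operators are spanned by a nilpotent operator with a $1$-dimensional eigenspace.
   Context: Coordinates on $\mathbb{C}^{n+1}$ are $z=(z_0,\dots,z_n)$ with $z_j=x_j+iy_j$. The sum runs over all ordered pairs of positive integers $(j,k)$ with $j+k\le n$. For a real hypersurface $M\subset\mathbb{C}^{n+1}$, let $H=T^{1,0}M\subset\mathbb{C}TM$ be its holomorphic tangent bundle (complex rank $n$), let $\mathcal{L}$ be its Levi form, and let $K_q=\{v\in H_q : \mathcal{L}(v,w)=0\ \forall w\in H_q\}$ be the Levi kernel at $q\in M$. When $K$ is a bundle (constant rank), the Levi kernel adjoint operator of $v\in K_q$ is the antilinear map $\mathrm{ad}_v:H_q/K_q\to H_q/K_q$ defined by choosing a section $V\in\Gamma(K)$ with $V_q=v$ and setting $$\mathrm{ad}_v(X_q+K_q):=[V,\overline{X}]_q \pmod{\overline{H}\oplus K}\qquad\text{for } X\in\Gamma(H);$$ the bracket takes values in $H\oplus\overline H$ because $V$ lies in the Levi kernel, $(H\oplus\overline H)/(\overline H\oplus K)$ is identified with $H/K$, and the result depends only on $v$ and on $X_q$ modulo $K_q$. For a hypersurface whose Levi kernel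 has constant positive rank, $2$-nondegeneracy at $q$ means that the map $v\mapsto\mathrm{ad}_v$ is injective on $K_q$. *)

theory Defs
  imports "HOL-Analysis.Analysis" "HOL-Library.Set_Algebras" "HOL-Library.FuncSet"
begin

section \<open>Complexified vectors\<close>

text \<open>The complexification of a real vector space \<open>'a\<close>: the pair \<open>(u, v)\<close> stands for
  \<open>u + \<i> v\<close>.\<close>

type_synonym 'a cplxn = "'a \<times> 'a"

definition cscale :: "complex \<Rightarrow> 'a::real_vector cplxn \<Rightarrow> 'a cplxn" where
  "cscale c V = (Re c *\<^sub>R fst V - Im c *\<^sub>R snd V, Im c *\<^sub>R fst V + Re c *\<^sub>R snd V)"

definition cconj :: "'a::real_vector cplxn \<Rightarrow> 'a cplxn" where
  "cconj V = (fst V, - snd V)"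

interpretation cplxn: vector_space "cscale :: complex \<Rightarrow> 'a::real_vector cplxn \<Rightarrow> 'a cplxn"
  by unfold_locales (auto simp: cscale_def algebra_simps)

section \<open>Quotients of complexified vectors\<close>

text \<open>The quotient \<open>H/K\<close> is the set of cosets \<open>x + K\<close> with \<open>x \<in> H\<close>; its zero is \<open>K\<close>. Adding \<open>K\<close> in the
  scaling makes the case \<open>c = 0\<close> come out as \<open>K\<close>; for \<open>c \<noteq> 0\<close> it has no effect.\<close>

definition quotient_space :: "'a::real_vector cplxn set \<Rightarrow> 'a cplxn set \<Rightarrow> 'a cplxn set set" where
  "quotient_space H K = (\<lambda>x. x +o K) ` H"

definition coset_scale ::
  "'a::real_vector cplxn set \<Rightarrow> complex \<Rightarrow> 'a cplxn set \<Rightarrow> 'a cplxn set" where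
  "coset_scale K c \<xi> = cscale c ` \<xi> + K"

definition operator_span ::
  "'a::real_vector cplxn set \<Rightarrow> 'a cplxn set \<Rightarrow> ('a cplxn set \<Rightarrow> 'a cplxn set)
     \<Rightarrow> ('a cplxn set \<Rightarrow> 'a cplxn set) set" where
  "operator_span H K A = {\<lambda>\<xi>\<in>quotient_space H K. coset_scale K c (A \<xi>) | c. True}"

definition nilpotent_operator ::
  "'a::real_vector cplxn set \<Rightarrow> 'a cplxn set \<Rightarrow> ('a cplxn set \<Rightarrow> 'a cplxn set) \<Rightarrow> bool" where
  "nilpotent_operator H K A \<longleftrightarrow> (\<exists>m. \<forall>\<xi>\<in>quotient_space H K. (A ^^ m) \<xi> = K)"

definition eigenspace ::
  "'a::real_vector cplxn set \<Rightarrow> 'a cplxn set \<Rightarrow> ('a cplxn set \<Rightarrow> 'a cplxn set) \<Rightarrow> complex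
     \<Rightarrow> 'a cplxn set set" where
  "eigenspace H K A c = {\<xi> \<in> quotient_space H K. A \<xi> = coset_scale K c \<xi>}"

text \<open>A set of cosets which is a complex subspace of dimension one.\<close>

definition one_dimensional ::
  "'a::real_vector cplxn set \<Rightarrow> 'a cplxn set \<Rightarrow> 'a cplxn set set \<Rightarrow> bool" where
  "one_dimensional H K E \<longleftrightarrow>
     (\<exists>\<xi>\<in>quotient_space H K. \<xi> \<noteq> K \<and> E = {coset_scale K c \<xi> | c. True})"

section \<open>Real hypersurfaces\<close>

text \<open>The ambient space is \<open>complex ^ 'i\<close>, and everything below is attached to the point set \<open>M\<close>.
  Tangent vectors are velocities of curves in \<open>M\<close>, which need to be differentiable at \<open>0\<close> only.\<close>

definition tangent_space :: "(complex ^ 'i::finite) set \<Rightarrow> complex ^ 'i \<Rightarrow> (complex ^ 'i) set" where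
  "tangent_space M q =
     {u. \<exists>\<gamma>::real \<Rightarrow> complex ^ 'i.
           \<gamma> 0 = q \<and> (\<forall>t. \<gamma> t \<in> M) \<and> (\<gamma> has_vector_derivative u) (at 0)}"

definition complex_tangent_space ::
  "(complex ^ 'i::finite) set \<Rightarrow> complex ^ 'i \<Rightarrow> (complex ^ 'i) cplxn set" where
  "complex_tangent_space M q = tangent_space M q \<times> tangent_space M q"

text \<open>The complex-linear extension of the complex structure \<open>J u = \<i> u\<close> of the ambient space
  must not be confused with \<open>cscale \<i>\<close>: \<open>T\<^sup>1\<^sup>,\<^sup>0\<close> is where the two agree.\<close>

definition cplx_structure :: "(complex ^ 'i::finite) cplxn \<Rightarrow> (complex ^ 'i) cplxn" where
  "cplx_structure V = (\<i> *s fst V, \<i> *s snd V)"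

definition hol_tangent_space ::
  "(complex ^ 'i::finite) set \<Rightarrow> complex ^ 'i \<Rightarrow> (complex ^ 'i) cplxn set" where
  "hol_tangent_space M q = {V \<in> complex_tangent_space M q. cplx_structure V = cscale \<i> V}"

definition antihol_tangent_space ::
  "(complex ^ 'i::finite) set \<Rightarrow> complex ^ 'i \<Rightarrow> (complex ^ 'i) cplxn set" where
  "antihol_tangent_space M q = cconj ` hol_tangent_space M q"

text \<open>Sections are pointwise differentiable along \<open>M\<close>: this is the regularity at which brackets make
  sense, and a hypersurface that is only twice differentiable has no smoother frames of
  \<open>T\<^sup>1\<^sup>,\<^sup>0M\<close> in general.\<close>

definition sections ::
  "(complex ^ 'i::finite) set \<Rightarrow> (complex ^ 'i \<Rightarrow> (complex ^ 'i) cplxn set)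
     \<Rightarrow> (complex ^ 'i \<Rightarrow> (complex ^ 'i) cplxn) set" where
  "sections M E = {X. X differentiable_on M \<and> (\<forall>p\<in>M. X p \<in> E p)}"

text \<open>Derivative at \<open>q\<close> of the vector field \<open>X\<close> in the complexified tangent direction \<open>V\<close>. The derivative
  within \<open>M\<close> is not unique as a linear map on the ambient space, but its values on vectors
  tangent to \<open>M\<close> are.\<close>

definition cderiv ::
  "(complex ^ 'i::finite) set \<Rightarrow> complex ^ 'i \<Rightarrow> (complex ^ 'i \<Rightarrow> (complex ^ 'i) cplxn)
     \<Rightarrow> (complex ^ 'i) cplxn \<Rightarrow> (complex ^ 'i) cplxn" where
  "cderiv M q X V = frechet_derivative X (at q within M) (fst V)
     + cscale \<i> (frechet_derivative X (at q within M) (snd V))"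

definition lie_bracket ::
  "(complex ^ 'i::finite) set \<Rightarrow> (complex ^ 'i \<Rightarrow> (complex ^ 'i) cplxn)
     \<Rightarrow> (complex ^ 'i \<Rightarrow> (complex ^ 'i) cplxn) \<Rightarrow> complex ^ 'i \<Rightarrow> (complex ^ 'i) cplxn" where
  "lie_bracket M X Y q = cderiv M q Y (X q) - cderiv M q X (Y q)"

text \<open>The Levi form takes values in the quotient of \<open>\<complex>TM\<close> by \<open>H \<oplus> H'\<close>, where \<open>H'\<close> is the conjugate of
  \<open>H\<close>, and is normalised as \<open>\<i>/2\<close> times the bracket of \<open>X\<close> with the conjugate of \<open>Y\<close>. Here and for
  the adjoint operators, the definite description is the common value over all choices of sections.\<close>

definition levi_form ::
  "(complex ^ 'i::finite) set \<Rightarrow> complex ^ 'i \<Rightarrow> (complex ^ 'i) cplxn \<Rightarrow> (complex ^ 'i) cplxn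
     \<Rightarrow> (complex ^ 'i) cplxn set" where
  "levi_form M q v w =
     (THE l. \<forall>X \<in> sections M (hol_tangent_space M). \<forall>Y \<in> sections M (hol_tangent_space M).
        X q = v \<and> Y q = w \<longrightarrow>
        l = cscale (\<i> / 2) (lie_bracket M X (\<lambda>p. cconj (Y p)) q)
              +o (hol_tangent_space M q + antihol_tangent_space M q))"

definition levi_kernel ::
  "(complex ^ 'i::finite) set \<Rightarrow> complex ^ 'i \<Rightarrow> (complex ^ 'i) cplxn set" where
  "levi_kernel M q =
     {v \<in> hol_tangent_space M q. \<forall>w \<in> hol_tangent_space M q.
        levi_form M q v w = hol_tangent_space M q + antihol_tangent_space M q}"

text \<open>Intersecting with \<open>H\<close> realises the identification of \<open>(H \<oplus> H')/(H' \<oplus> K)\<close> with \<open>H/K\<close>.\<close>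

definition levi_adjoint ::
  "(complex ^ 'i::finite) set \<Rightarrow> complex ^ 'i \<Rightarrow> (complex ^ 'i) cplxn
     \<Rightarrow> (complex ^ 'i) cplxn set \<Rightarrow> (complex ^ 'i) cplxn set" where
  "levi_adjoint M q v =
     (\<lambda>\<xi> \<in> quotient_space (hol_tangent_space M q) (levi_kernel M q).
        THE \<eta>. \<forall>V \<in> sections M (levi_kernel M). \<forall>X \<in> sections M (hol_tangent_space M).
          V q = v \<and> X q \<in> \<xi> \<longrightarrow>
          \<eta> = (lie_bracket M V (\<lambda>p. cconj (X p)) q
                 +o (antihol_tangent_space M q + levi_kernel M q)) \<inter> hol_tangent_space M q)"

definition two_nondegenerate_at :: "(complex ^ 'i::finite) set \<Rightarrow> complex ^ 'i \<Rightarrow> bool" where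
  "two_nondegenerate_at M q \<longleftrightarrow>
     (\<exists>r>0. \<forall>p\<in>M. cplxn.dim (levi_kernel M p) = r) \<and> inj_on (levi_adjoint M q) (levi_kernel M q)"

definition uniformly_two_nondegenerate :: "(complex ^ 'i::finite) set \<Rightarrow> bool" where
  "uniformly_two_nondegenerate M \<longleftrightarrow> (\<forall>q\<in>M. two_nondegenerate_at M q)"

section \<open>The hypersurfaces\<close>

text \<open>\<open>e\<close> enumerates the coordinates of \<open>complex ^ 'i\<close> as \<open>0, \<dots>, n\<close>.\<close>

definition hypersurface ::
  "nat \<Rightarrow> (nat \<Rightarrow> 'i::finite) \<Rightarrow> (real \<Rightarrow> real) \<Rightarrow> (complex ^ 'i) set" where
  "hypersurface n e f =
     {z. let x = (\<lambda>j. Re (z $ e j)) in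
         x 0 = f (x 1) + (\<Sum>(j, k) \<in> {(j, k). 0 < j \<and> j < j + k \<and> j + k \<le> n}.
                            x j * x k * x n ^ (n - j - k))}"

end

theory Submission
  imports Defs
begin

text \<open>
  Write \<open>t = x\<^sub>n\<close> and \<open>X(s) = \<Sum> x\<^sub>k s\<^sup>k\<close>, \<open>Y(s) = \<Sum> y\<^sub>k s\<^sup>k = X(s) / (1 - t s)\<close>. The quadratic form in the
  equation of the hypersurface is the coefficient of \<open>s\<^sup>n\<close> in \<open>X Y = (1 - t s) Y\<^sup>2\<close>, which is affine in
  \<open>t\<close> once the \<open>y\<^sub>k\<close> are frozen. Hence the real base is ruled by lines on which \<open>y\<^sub>1, \<dots>, y\<^sub>n\<^sub>-\<^sub>1\<close>, and with them
  the gradient, are constant; the term \<open>f(x\<^sub>1)\<close> does not interfere because \<open>x\<^sub>1 = y\<^sub>1\<close>. The direction \<open>w\<close>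
  of these lines has \<open>w\<^sub>k = - y\<^sub>k\<^sub>-\<^sub>1\<close> for \<open>0 < k < n\<close> and \<open>w\<^sub>n = 1\<close>. The Hessian in
  \<open>x\<^sub>1, \<dots>, x\<^sub>n\<^sub>-\<^sub>1\<close> is triangular with respect to the antidiagonal \<open>j + k = n\<close>, where its entries are \<open>2\<close>,
  so \<open>w\<close> spans the Levi kernel. The adjoint operator of \<open>w\<close> sends \<open>b\<close> to minus the derivative of \<open>w\<close>
  in the direction of the conjugate of \<open>b\<close>; modulo \<open>w\<close> this is conjugation followed by a strictly lower
  triangular matrix with non-zero subdiagonal.\<close>

section \<open>Complexified vectors of type (1,0) and (0,1)\<close>

text \<open>The vector u - i J u, twice the (1,0) part of u. Every (1,0) vector has this form, so
  coefficient vectors in \<open>complex ^ 'i\<close> can replace pairs from here on.\<close>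

definition hol_vec :: "complex ^ 'i::finite \<Rightarrow> (complex ^ 'i) cplxn" where
  "hol_vec u = (u, - (\<i> *s u))"

definition antihol_vec :: "complex ^ 'i::finite \<Rightarrow> (complex ^ 'i) cplxn" where
  "antihol_vec u = (u, \<i> *s u)"

definition vre :: "complex ^ 'i::finite \<Rightarrow> complex ^ 'i" where
  "vre u = (\<chi> i. of_real (Re (u $ i)))"

definition vcnj :: "complex ^ 'i::finite \<Rightarrow> complex ^ 'i" where
  "vcnj u = (\<chi> i. cnj (u $ i))"

text \<open>Bilinear, without conjugation: the pairing of a (1,0)-form with a coefficient
  vector.\<close>

definition vdot :: "complex ^ 'i::finite \<Rightarrow> complex ^ 'i \<Rightarrow> complex" where
  "vdot a b = (\<Sum>i\<in>UNIV. a $ i * b $ i)"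

lemma vre_nth [simp]: "vre u $ i = of_real (Re (u $ i))"
  by (simp add: vre_def)

lemma vcnj_nth [simp]: "vcnj u $ i = cnj (u $ i)"
  by (simp add: vcnj_def)

lemma vcnj_add [simp]: "vcnj (u + v) = vcnj u + vcnj v"
  and vcnj_scale [simp]: "vcnj (c *s u) = cnj c *s vcnj u"
  by (simp_all add: vec_eq_iff)

text \<open>Coordinatewise, Re u + i Re (i u) = Re u - i Im u. The data of a tube vary with real
  parts only, so this turns a derivative in a conjugate direction into a complex linear map applied
  to \<open>vcnj u\<close>.\<close>

lemma vre_plus_i_vre: "vre u + \<i> *s vre (\<i> *s u) = vcnj u"
  by (simp add: vec_eq_iff complex_eq_iff)

lemma vdot_add_right: "vdot a (b + c) = vdot a b + vdot a c"
  and vdot_add_left: "vdot (a + b) c = vdot a c + vdot b c"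
  and vdot_scale_right: "vdot a (s *s b) = s * vdot a b"
  and vdot_scale_left: "vdot (s *s a) b = s * vdot a b"
  and vdot_minus_right: "vdot a (- b) = - vdot a b"
  and vdot_diff_right: "vdot a (b - c) = vdot a b - vdot a c"
  and vdot_zero_right: "vdot a 0 = 0"
  and vdot_zero_left: "vdot 0 a = 0"
  and vdot_axis_right: "vdot a (axis i s) = a $ i * s"
  by (simp_all add: vdot_def algebra_simps sum.distrib sum_distrib_left sum_negf sum_subtractf
      axis_def if_distrib cong: if_cong)

lemmas vdot_simps = vdot_add_right vdot_add_left vdot_scale_right vdot_scale_left vdot_minus_right
  vdot_diff_right vdot_zero_right vdot_zero_left vdot_axis_right

lemma bounded_bilinear_vdot: "bounded_bilinear (vdot :: complex ^ 'i::finite \<Rightarrow> _)"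
  unfolding bilinear_conv_bounded_bilinear[symmetric] bilinear_def
  by (auto intro!: linearI simp: vdot_def algebra_simps sum.distrib scaleR_sum_right)

lemma bounded_bilinear_vector_scalar_mult:
  "bounded_bilinear ((*s) :: complex \<Rightarrow> complex ^ 'i::finite \<Rightarrow> _)"
  unfolding bilinear_conv_bounded_bilinear[symmetric] bilinear_def
  by (auto intro!: linearI simp: vec_eq_iff algebra_simps)

lemma bounded_linear_cconj: "bounded_linear (cconj :: 'a::euclidean_space cplxn \<Rightarrow> _)"
  unfolding linear_conv_bounded_linear[symmetric]
  by (auto intro!: linearI simp: cconj_def)

lemma bounded_linear_hol_vec: "bounded_linear (hol_vec :: complex ^ 'i::finite \<Rightarrow> _)"
  unfolding linear_conv_bounded_linear[symmetric]
  by (auto intro!: linearI simp: hol_vec_def vec_eq_iff algebra_simps)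

lemma hol_vec_add: "hol_vec (u + v) = hol_vec u + hol_vec v"
  and hol_vec_diff: "hol_vec (u - v) = hol_vec u - hol_vec v"
  and hol_vec_minus: "hol_vec (- u) = - hol_vec u"
  and hol_vec_zero [simp]: "hol_vec 0 = 0"
  and hol_vec_scale: "hol_vec (c *s u) = cscale c (hol_vec u)"
  and antihol_vec_add: "antihol_vec (u + v) = antihol_vec u + antihol_vec v"
  and antihol_vec_diff: "antihol_vec (u - v) = antihol_vec u - antihol_vec v"
  and antihol_vec_minus: "antihol_vec (- u) = - antihol_vec u"
  and antihol_vec_zero [simp]: "antihol_vec 0 = 0"
  and antihol_vec_scale: "antihol_vec (cnj c *s u) = cscale c (antihol_vec u)"
  and cconj_hol_vec [simp]: "cconj (hol_vec u) = antihol_vec u"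
  by (auto simp: hol_vec_def antihol_vec_def cscale_def cconj_def vec_eq_iff algebra_simps
      complex_eq_iff zero_prod_def)

lemma fst_hol_vec [simp]: "fst (hol_vec u) = u"
  by (simp add: hol_vec_def)

lemma hol_vec_eq_iff [simp]: "hol_vec u = hol_vec v \<longleftrightarrow> u = v"
  by (auto simp: hol_vec_def)

lemma hol_vec_eq_0_iff [simp]: "hol_vec u = 0 \<longleftrightarrow> u = 0"
  using hol_vec_eq_iff[of u 0] by simp

text \<open>The two components of the equation determine u + v and u - v: vectors of types (1,0) and
  (0,1) form a direct sum.\<close>

lemma hol_antihol_eq:
  assumes "hol_vec u + antihol_vec v = hol_vec u' + antihol_vec v'"
  shows "u = u'" "v = v'"
proof -
  have 1: "u $ i + v $ i = u' $ i + v' $ i" and 2: "- (\<i> * u $ i) + \<i> * v $ i = - (\<i> * u' $ i) + \<i> * v' $ i" for i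
    using assms by (auto simp: hol_vec_def antihol_vec_def vec_eq_iff)
  have "u $ i = u' $ i \<and> v $ i = v' $ i" for i
    using 1[of i] 2[of i] by (simp add: complex_eq_iff)
  then show "u = u'" "v = v'" by (auto simp: vec_eq_iff)
qed

section \<open>Tangent spaces as velocities of curves\<close>

lemma bounded_linear_Re_vec_nth: "bounded_linear (\<lambda>p :: complex ^ 'i::finite. Re (p $ k))"
  by (rule bounded_linear_compose[OF bounded_linear_Re bounded_linear_vec_nth])

text \<open>Composing with a curve in \<open>M\<close> of velocity \<open>u\<close> reduces the
  claim to uniqueness of derivatives in one real variable. As \<open>X\<close> and \<open>Y\<close>
  may differ off \<open>M\<close>, any identity on \<open>M\<close> can be differentiated in tangent
  directions.\<close>

lemma tangent_space_diff_unique: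
  fixes X :: "complex ^ 'i::finite \<Rightarrow> 'b::real_normed_vector"
  assumes "u \<in> tangent_space M q"
    and "(X has_derivative D) (at q within M)" and "(Y has_derivative E) (at q within M)"
    and "\<And>p. p \<in> M \<Longrightarrow> X p = Y p"
  shows "D u = E u"
proof -
  obtain \<gamma> :: "real \<Rightarrow> complex ^ 'i" where \<gamma>: "\<gamma> 0 = q" "\<And>t. \<gamma> t \<in> M"
    "(\<gamma> has_vector_derivative u) (at 0)"
    using assms(1) by (auto simp: tangent_space_def)
  have *: "((\<lambda>t. Z (\<gamma> t)) has_vector_derivative F u) (at 0)"
    if "(Z has_derivative F) (at q within M)" for Z :: "complex ^ 'i \<Rightarrow> 'b" and F
  proof -
    have "(Z has_derivative F) (at (\<gamma> 0) within range \<gamma>)"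
      using has_derivative_subset[OF that, of "range \<gamma>"] \<gamma> by auto
    from vector_derivative_diff_chain_within[of \<gamma> u 0 UNIV Z F] \<gamma>(3) this
    show ?thesis by (simp add: o_def)
  qed
  have "(\<lambda>t. X (\<gamma> t)) = (\<lambda>t. Y (\<gamma> t))" using \<gamma>(2) assms(4) by auto
  with *[OF assms(2)] *[OF assms(3)] show ?thesis
    by (metis vector_derivative_unique_at)
qed

text \<open>One inclusion differentiates the equation on \<open>M\<close>. For the other, a straight
  line is pushed back onto the graph along coordinate \<open>k\<close>, which leaves
  \<open>F\<close> unchanged by \<open>inv\<close>.\<close>

lemma tangent_space_graph:
  fixes F :: "complex ^ 'i::finite \<Rightarrow> real" and k :: 'i
  defines "M \<equiv> {p. Re (p $ k) = F p}"
  assumes "q \<in> M" and F: "(F has_derivative F') (at q)" and inv: "\<And>p c. F (p + axis k c) = F p"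
  shows "tangent_space M q = {u. Re (u $ k) = F' u}"
proof (intro equalityI subsetI CollectI)
  fix u assume u: "u \<in> tangent_space M q"
  have 1: "((\<lambda>p. Re (p $ k)) has_derivative (\<lambda>u. Re (u $ k))) (at q within M)"
    by (rule bounded_linear_imp_has_derivative[OF bounded_linear_Re_vec_nth])
  show "Re (u $ k) = F' u"
    by (rule tangent_space_diff_unique[OF u 1 has_derivative_at_withinI[OF F]]) (simp add: M_def)
next
  fix u assume "u \<in> {u. Re (u $ k) = F' u}"
  then have u: "Re (u $ k) = F' u" by simp
  define \<gamma> where "\<gamma> t = (q + t *\<^sub>R u) + axis k (of_real (F (q + t *\<^sub>R u) - Re ((q + t *\<^sub>R u) $ k)))"
    for t :: real
  have lin: "bounded_linear (\<lambda>x::real. axis k (complex_of_real x) :: complex ^ 'i)"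
    unfolding linear_conv_bounded_linear[symmetric]
    by (auto intro!: linearI simp: vec_eq_iff axis_def complex_eq_iff)
  have lin2: "bounded_linear F'" using F by (rule has_derivative_bounded_linear)
  have 1: "((\<lambda>t. q + t *\<^sub>R u) has_derivative (\<lambda>t. t *\<^sub>R u)) (at (0::real))"
    by (auto intro!: derivative_eq_intros)
  have 2: "((\<lambda>t. F (q + t *\<^sub>R u)) has_derivative (\<lambda>t. F' (t *\<^sub>R u))) (at (0::real))"
    using has_derivative_compose[OF 1, of F F'] F by simp
  have 3: "((\<lambda>t. Re ((q + t *\<^sub>R u) $ k)) has_derivative (\<lambda>t. Re ((t *\<^sub>R u) $ k))) (at (0::real))"
    by (rule bounded_linear.has_derivative[OF bounded_linear_Re_vec_nth 1])
  have "(\<gamma> has_derivative (\<lambda>t. t *\<^sub>R u + axis k (of_real (F' (t *\<^sub>R u) - Re ((t *\<^sub>R u) $ k))))) (at 0)"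
    unfolding \<gamma>_def
    by (intro has_derivative_add[OF 1] bounded_linear.has_derivative[OF lin] has_derivative_diff 2 3)
  \<comment> \<open>The correction vanishes to first order because \<open>u\<close> solves the
    linearised equation.\<close>
  moreover have "F' (t *\<^sub>R u) - Re ((t *\<^sub>R u) $ k) = 0" for t
    using u by (simp add: linear_scale[OF bounded_linear.linear[OF lin2]])
  moreover have "axis k (0::complex) = 0" by (simp add: vec_eq_iff axis_def)
  ultimately have "(\<gamma> has_vector_derivative u) (at 0)"
    by (simp only: has_vector_derivative_def of_real_0 add_0_right)
  moreover have "\<gamma> 0 = q" using \<open>q \<in> M\<close> by (simp add: \<gamma>_def M_def axis_def vec_eq_iff)
  moreover have "\<gamma> t \<in> M" for t
  proof -
    have "F (\<gamma> t) = F (q + t *\<^sub>R u)" unfolding \<gamma>_def by (rule inv)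
    then show ?thesis by (simp add: M_def \<gamma>_def)
  qed
  ultimately show "u \<in> tangent_space M q" unfolding tangent_space_def by blast
qed

lemma mem_hol_tangent_space:
  "V \<in> hol_tangent_space M q \<longleftrightarrow>
    (\<exists>u. V = hol_vec u \<and> u \<in> tangent_space M q \<and> - (\<i> *s u) \<in> tangent_space M q)"
proof -
  have "cplx_structure V = cscale \<i> V \<longleftrightarrow> V = hol_vec (fst V)"
    by (cases V) (auto simp: cplx_structure_def cscale_def hol_vec_def vec_eq_iff complex_eq_iff)
  then show ?thesis
    by (auto simp: hol_tangent_space_def complex_tangent_space_def hol_vec_def)
qed

section \<open>Levi form of a tubular hypersurface\<close>

text \<open>\<open>vdot (\<nu> q)\<close> is the form of type (1,0) that annihilates \<open>T\<^sup>1\<^sup>,\<^sup>0M\<close>. For a tube it only depends on the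
  real parts of the coordinates, so its derivative is the complex linear \<open>d\<nu> q\<close> applied to \<open>vre u\<close>.\<close>

locale tube_form =
  fixes M :: "(complex ^ 'i::finite) set" and k\<^sub>0 :: 'i
    and \<nu> :: "complex ^ 'i \<Rightarrow> complex ^ 'i" and d\<nu> :: "complex ^ 'i \<Rightarrow> complex ^ 'i \<Rightarrow> complex ^ 'i"
  assumes tangent: "q \<in> M \<Longrightarrow> tangent_space M q = {u. Re (vdot (\<nu> q) u) = 0}"
    and nu_deriv: "q \<in> M \<Longrightarrow> (\<nu> has_derivative (\<lambda>u. d\<nu> q (vre u))) (at q within M)"
    and dnu_linear: "Vector_Spaces.linear (*s) (*s) (d\<nu> q)"
    and nu_base: "\<nu> q $ k\<^sub>0 = 1"
begin

lemma dnu_combine: "d\<nu> q (vre u) + \<i> *s d\<nu> q (vre (\<i> *s u)) = d\<nu> q (vcnj u)"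
  by (simp add: vec.linear_add[OF dnu_linear, symmetric] vec.linear_scale[OF dnu_linear, symmetric]
      vre_plus_i_vre)

section \<open>Holomorphic tangent vectors and cosets of H + H'\<close>

text \<open>Tangency of \<open>u\<close> and of \<open>- (\<i> *s u)\<close> makes the real and the
  imaginary part of \<open>vdot (\<nu> q) u\<close> vanish.\<close>

lemma mem_hol:
  assumes "q \<in> M"
  shows "V \<in> hol_tangent_space M q \<longleftrightarrow> (\<exists>u. V = hol_vec u \<and> vdot (\<nu> q) u = 0)"
  unfolding mem_hol_tangent_space tangent[OF assms]
  by (simp add: vdot_simps complex_eq_iff)

lemma hol_vec_mem_hol [simp]:
  "q \<in> M \<Longrightarrow> hol_vec u \<in> hol_tangent_space M q \<longleftrightarrow> vdot (\<nu> q) u = 0"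
  by (auto simp: mem_hol)

lemma mem_antihol:
  assumes "q \<in> M"
  shows "V \<in> antihol_tangent_space M q \<longleftrightarrow> (\<exists>u. V = antihol_vec u \<and> vdot (\<nu> q) u = 0)"
  unfolding antihol_tangent_space_def image_iff Bex_def mem_hol[OF assms]
  by (metis cconj_hol_vec)

lemma mem_sum:
  assumes "q \<in> M"
  shows "V \<in> hol_tangent_space M q + antihol_tangent_space M q
    \<longleftrightarrow> (\<exists>u v. V = hol_vec u + antihol_vec v \<and> vdot (\<nu> q) u = 0 \<and> vdot (\<nu> q) v = 0)"
  unfolding set_plus_def mem_Collect_eq Bex_def mem_hol[OF assms] mem_antihol[OF assms]
  by blast

text \<open>Written for the difference in which brackets come out below; directness of the sum
  splits membership into one scalar condition per type.\<close>

lemma hol_antihol_mem_sum: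
  assumes "q \<in> M"
  shows "antihol_vec v - hol_vec u \<in> hol_tangent_space M q + antihol_tangent_space M q
    \<longleftrightarrow> vdot (\<nu> q) u = 0 \<and> vdot (\<nu> q) v = 0"
proof
  assume "antihol_vec v - hol_vec u \<in> hol_tangent_space M q + antihol_tangent_space M q"
  then obtain u' v' where *: "antihol_vec v - hol_vec u = hol_vec u' + antihol_vec v'"
    "vdot (\<nu> q) u' = 0" "vdot (\<nu> q) v' = 0"
    unfolding mem_sum[OF assms] by blast
  then have "hol_vec (- u) + antihol_vec v = hol_vec u' + antihol_vec v'"
    by (simp add: hol_vec_minus)
  from hol_antihol_eq[OF this] * show "vdot (\<nu> q) u = 0 \<and> vdot (\<nu> q) v = 0"
    by (metis add.inverse_inverse neg_equal_0_iff_equal vdot_minus_right)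
next
  assume "vdot (\<nu> q) u = 0 \<and> vdot (\<nu> q) v = 0"
  then have "hol_vec (- u) + antihol_vec v \<in> hol_tangent_space M q + antihol_tangent_space M q"
    by (intro set_plus_intro) (auto simp: assms vdot_simps mem_antihol)
  then show "antihol_vec v - hol_vec u \<in> hol_tangent_space M q + antihol_tangent_space M q"
    by (simp add: hol_vec_minus)
qed

lemma sum_subspace:
  assumes "q \<in> M"
    and "x \<in> hol_tangent_space M q + antihol_tangent_space M q"
    and "y \<in> hol_tangent_space M q + antihol_tangent_space M q"
  shows "x + y \<in> hol_tangent_space M q + antihol_tangent_space M q"
    and "cscale c x \<in> hol_tangent_space M q + antihol_tangent_space M q"
proof -
  have *: "\<exists>u v. z = antihol_vec v - hol_vec u \<and> vdot (\<nu> q) u = 0 \<and> vdot (\<nu> q) v = 0"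
    if z: "z \<in> hol_tangent_space M q + antihol_tangent_space M q" for z
  proof -
    obtain u v where "z = hol_vec u + antihol_vec v" "vdot (\<nu> q) u = 0" "vdot (\<nu> q) v = 0"
      using z unfolding mem_sum[OF assms(1)] by metis
    then show ?thesis by (intro exI[of _ "-u"] exI[of _ v]) (simp add: hol_vec_minus vdot_simps)
  qed
  obtain u v u' v' where uv: "x = antihol_vec v - hol_vec u" "vdot (\<nu> q) u = 0" "vdot (\<nu> q) v = 0"
    "y = antihol_vec v' - hol_vec u'" "vdot (\<nu> q) u' = 0" "vdot (\<nu> q) v' = 0"
    using *[OF assms(2)] *[OF assms(3)] by blast
  have "x + y = antihol_vec (v + v') - hol_vec (u + u')"
    by (simp add: uv hol_vec_add antihol_vec_add)
  then show "x + y \<in> hol_tangent_space M q + antihol_tangent_space M q"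
    using uv by (simp add: hol_antihol_mem_sum assms(1) vdot_simps)
  have "cscale c x = antihol_vec (cnj c *s v) - hol_vec (c *s u)"
    by (simp add: uv hol_vec_scale antihol_vec_scale cplxn.scale_right_diff_distrib)
  then show "cscale c x \<in> hol_tangent_space M q + antihol_tangent_space M q"
    using uv by (simp add: hol_antihol_mem_sum assms(1) vdot_simps)
qed

lemma sum_coset_eq_iff:
  assumes "q \<in> M"
  defines "S \<equiv> hol_tangent_space M q + antihol_tangent_space M q"
  shows "x +o S = y +o S \<longleftrightarrow> x - y \<in> S"
proof -
  have m: "- z \<in> S" if "z \<in> S" for z
    using sum_subspace(2)[OF assms(1), of z z "-1"] that by (simp add: S_def cplxn.scale_minus_left)
  have a: "z + z' \<in> S" if "z \<in> S" "z' \<in> S" for z z'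
    using sum_subspace(1)[OF assms(1)] that by (simp add: S_def)
  have 0: "0 \<in> S"
    using sum_subspace(2)[OF assms(1), of "antihol_vec 0 - hol_vec 0" _ 0]
      hol_antihol_mem_sum[OF assms(1), of 0 0]
    by (simp add: S_def vdot_simps)
  show ?thesis
  proof
    assume "x +o S = y +o S"
    moreover have "x \<in> x +o S" using 0 by (force simp: elt_set_plus_def)
    ultimately show "x - y \<in> S" by (auto simp: elt_set_plus_def)
  next
    assume *: "x - y \<in> S"
    show "x +o S = y +o S"
    proof (auto simp: elt_set_plus_def)
      fix s assume "s \<in> S"
      then show "\<exists>b\<in>S. x + s = y + b" using a[OF *] by (intro bexI[of _ "x - y + s"]) auto
      show "\<exists>b\<in>S. y + s = x + b" using a[OF m[OF *] \<open>s \<in> S\<close>]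
        by (intro bexI[of _ "- (x - y) + s"]) auto
    qed
  qed
qed

text \<open>A constant vector field becomes tangent by a correction in the direction \<open>k\<^sub>0\<close> only.\<close>

lemma section_through:
  assumes "q \<in> M" "V \<in> hol_tangent_space M q"
  obtains X where "X \<in> sections M (hol_tangent_space M)" "X q = V"
proof -
  obtain u where u: "V = hol_vec u" "vdot (\<nu> q) u = 0"
    using assms by (auto simp: mem_hol)
  define X where "X p = hol_vec (u - vdot (\<nu> p) u *s axis k\<^sub>0 1)" for p
  have "X differentiable_on M"
    unfolding differentiable_on_def
  proof
    fix p assume p: "p \<in> M"
    note d = bounded_linear.has_derivative[OF bounded_linear_hol_vec has_derivative_diff[OF
          has_derivative_const bounded_linear.has_derivative[OF
          bounded_bilinear.bounded_linear_left[OF bounded_bilinear_vector_scalar_mult]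
          bounded_linear.has_derivative[OF bounded_bilinear.bounded_linear_left[OF bounded_bilinear_vdot]
           nu_deriv[OF p]]]]]
    show "X differentiable at p within M"
      unfolding X_def differentiable_def by (rule exI, rule d)
  qed
  moreover have "X p \<in> hol_tangent_space M p" if "p \<in> M" for p
    using that by (simp add: X_def vdot_simps nu_base)
  ultimately have "X \<in> sections M (hol_tangent_space M)" by (simp add: sections_def)
  moreover have "X q = V" using u by (simp add: X_def)
  ultimately show ?thesis using that by blast
qed

section \<open>Derivatives and brackets of sections\<close>

text \<open>A section of type (1,0) is determined by its first component, so only the derivative of
  that component is kept.\<close>

definition field_deriv :: "(complex ^ 'i \<Rightarrow> (complex ^ 'i) cplxn) \<Rightarrow> complex ^ 'i \<Rightarrow> complex ^ 'i \<Rightarrow> complex ^ 'i" where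
  "field_deriv X q u = fst (frechet_derivative X (at q within M) u)"

text \<open>Real derivatives in the directions \<open>u\<close> and \<open>\<i> u\<close> combine to the derivative in the direction
  of the conjugate of \<open>hol_vec u\<close>.\<close>

definition dbar :: "(complex ^ 'i \<Rightarrow> (complex ^ 'i) cplxn) \<Rightarrow> complex ^ 'i \<Rightarrow> complex ^ 'i \<Rightarrow> complex ^ 'i" where
  "dbar X q u = field_deriv X q u + \<i> *s field_deriv X q (\<i> *s u)"

lemma section_has_derivative:
  assumes "X \<in> sections M E" "q \<in> M"
  shows "(X has_derivative frechet_derivative X (at q within M)) (at q within M)"
    and "((\<lambda>p. fst (X p)) has_derivative field_deriv X q) (at q within M)"
proof -
  show 1: "(X has_derivative frechet_derivative X (at q within M)) (at q within M)"
    using assms by (auto simp: sections_def differentiable_on_def frechet_derivative_works)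
  show "((\<lambda>p. fst (X p)) has_derivative field_deriv X q) (at q within M)"
    unfolding field_deriv_def[abs_def] by (rule has_derivative_fst[OF 1])
qed

lemma section_hol_vec:
  assumes "X \<in> sections M (hol_tangent_space M)" "p \<in> M"
  shows "X p = hol_vec (fst (X p))" "vdot (\<nu> p) (fst (X p)) = 0"
  using assms mem_hol[OF assms(2), of "X p"] by (auto simp: sections_def)

text \<open>Confined to tangent \<open>u\<close>, where the chosen derivative within
  \<open>M\<close> is known to be determined; there it agrees with the derivative of
  \<open>hol_vec\<close> composed with the first component.\<close>

lemma frechet_section:
  assumes "X \<in> sections M (hol_tangent_space M)" "q \<in> M" "u \<in> tangent_space M q"
  shows "frechet_derivative X (at q within M) u = hol_vec (field_deriv X q u)"
proof -
  have "((\<lambda>p. hol_vec (fst (X p))) has_derivative (\<lambda>u. hol_vec (field_deriv X q u))) (at q within M)"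
    by (rule bounded_linear.has_derivative[OF bounded_linear_hol_vec section_has_derivative(2)[OF assms(1,2)]])
  from tangent_space_diff_unique[OF assms(3) section_has_derivative(1)[OF assms(1,2)] this]
  show ?thesis using section_hol_vec[OF assms(1)] by auto
qed

lemma frechet_cconj_section:
  assumes "X \<in> sections M (hol_tangent_space M)" "q \<in> M" "u \<in> tangent_space M q"
  shows "frechet_derivative (\<lambda>p. cconj (X p)) (at q within M) u = antihol_vec (field_deriv X q u)"
proof -
  have 1: "((\<lambda>p. cconj (X p)) has_derivative (\<lambda>u. cconj (frechet_derivative X (at q within M) u))) (at q within M)"
    by (rule bounded_linear.has_derivative[OF bounded_linear_cconj section_has_derivative(1)[OF assms(1,2)]])
  then have "(\<lambda>p. cconj (X p)) differentiable (at q within M)" by (auto simp: differentiable_def)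
  then have 2: "((\<lambda>p. cconj (X p)) has_derivative frechet_derivative (\<lambda>p. cconj (X p)) (at q within M)) (at q within M)"
    by (simp add: frechet_derivative_works)
  have "frechet_derivative (\<lambda>p. cconj (X p)) (at q within M) u = cconj (frechet_derivative X (at q within M) u)"
    by (rule tangent_space_diff_unique[OF assms(3) 2 1]) simp
  then show ?thesis by (simp add: frechet_section[OF assms])
qed

lemma field_deriv_neg:
  assumes "X \<in> sections M E" "q \<in> M"
  shows "field_deriv X q (- u) = - field_deriv X q u"
  by (metis assms has_derivative_bounded_linear bounded_linear.linear linear_neg section_has_derivative(2))

text \<open>The bracket splits by type: differentiating the conjugate of \<open>Y\<close> gives a
  (0,1) vector, differentiating \<open>X\<close> a (1,0) vector.\<close>

lemma lie_bracket_hol: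
  assumes X: "X \<in> sections M (hol_tangent_space M)" and Y: "Y \<in> sections M (hol_tangent_space M)"
    and q: "q \<in> M"
  shows "lie_bracket M X (\<lambda>p. cconj (Y p)) q
    = antihol_vec (dbar Y q (fst (X q))) - hol_vec (dbar X q (fst (Y q)))"
proof -
  define a where "a = fst (X q)"
  define b where "b = fst (Y q)"
  have a: "X q = hol_vec a" "vdot (\<nu> q) a = 0" and b: "Y q = hol_vec b" "vdot (\<nu> q) b = 0"
    unfolding a_def b_def using section_hol_vec[OF X q] section_hol_vec[OF Y q] by auto
  have t: "a \<in> tangent_space M q" "- (\<i> *s a) \<in> tangent_space M q" "b \<in> tangent_space M q"
    "\<i> *s b \<in> tangent_space M q"
    using a b by (simp_all add: tangent[OF q] vdot_simps)
  have "cderiv M q (\<lambda>p. cconj (Y p)) (X q)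
     = antihol_vec (field_deriv Y q a) + cscale \<i> (antihol_vec (field_deriv Y q (- (\<i> *s a))))"
    unfolding cderiv_def a(1) using frechet_cconj_section[OF Y q t(1)] frechet_cconj_section[OF Y q t(2)]
    by (simp add: hol_vec_def)
  \<comment> \<open>Antilinearity of \<open>antihol_vec\<close> turns the factor i into - i, and
    this sign cancels the one in the direction \<open>- (\<i> *s a)\<close>.\<close>
  also have "\<dots> = antihol_vec (dbar Y q a)"
    by (simp add: dbar_def field_deriv_neg[OF Y q] antihol_vec_add antihol_vec_scale[symmetric])
  finally have 1: "cderiv M q (\<lambda>p. cconj (Y p)) (X q) = antihol_vec (dbar Y q a)" .
  have "cderiv M q X (cconj (Y q))
     = hol_vec (field_deriv X q b) + cscale \<i> (hol_vec (field_deriv X q (\<i> *s b)))"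
    unfolding cderiv_def b(1) using frechet_section[OF X q t(3)] frechet_section[OF X q t(4)]
    by (simp add: antihol_vec_def)
  also have "\<dots> = hol_vec (dbar X q b)"
    by (simp add: dbar_def hol_vec_add hol_vec_scale)
  finally show ?thesis using 1 by (simp add: lie_bracket_def a_def b_def)
qed

text \<open>Differentiating \<open>vdot \<nu> X = 0\<close> along \<open>M\<close>: the Levi form is read off the derivative of \<open>\<nu>\<close>.\<close>

lemma vdot_dbar:
  assumes X: "X \<in> sections M (hol_tangent_space M)" and q: "q \<in> M" and u: "vdot (\<nu> q) u = 0"
  shows "vdot (\<nu> q) (dbar X q u) = - vdot (d\<nu> q (vcnj u)) (fst (X q))"
proof -
  have *: "vdot (\<nu> q) (field_deriv X q v) = - vdot (d\<nu> q (vre v)) (fst (X q))"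
    if "v \<in> tangent_space M q" for v
  proof -
    have "vdot (\<nu> q) (field_deriv X q v) + vdot (d\<nu> q (vre v)) (fst (X q)) = 0"
      by (rule tangent_space_diff_unique[OF that bounded_bilinear.FDERIV[OF bounded_bilinear_vdot
          nu_deriv[OF q] section_has_derivative(2)[OF X q]] has_derivative_const])
        (simp add: section_hol_vec(2)[OF X])
    then show ?thesis by (simp add: eq_neg_iff_add_eq_0)
  qed
  have "u \<in> tangent_space M q" "\<i> *s u \<in> tangent_space M q"
    using u by (simp_all add: tangent[OF q] vdot_simps)
  then have "vdot (\<nu> q) (dbar X q u)
     = - vdot (d\<nu> q (vre u) + \<i> *s d\<nu> q (vre (\<i> *s u))) (fst (X q))"
    by (simp add: dbar_def vdot_simps *)
  then show ?thesis by (simp add: dnu_combine)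
qed

section \<open>The Levi form and the Levi kernel\<close>

text \<open>By \<open>vdot_dbar\<close>, the values of \<open>\<nu>\<close> on both parts of the
  bracket depend only on \<open>X q\<close> and \<open>Y q\<close>. Hence brackets for two choices
  of sections differ by an element of H + H', and the definite description is legitimate.\<close>

lemma levi_form_eq:
  assumes X: "X \<in> sections M (hol_tangent_space M)" and Y: "Y \<in> sections M (hol_tangent_space M)"
    and q: "q \<in> M"
  shows "levi_form M q (X q) (Y q) = cscale (\<i> / 2) (lie_bracket M X (\<lambda>p. cconj (Y p)) q)
     +o (hol_tangent_space M q + antihol_tangent_space M q)"
  unfolding levi_form_def
proof (rule the_equality, intro ballI impI)
  fix X' Y' assume X': "X' \<in> sections M (hol_tangent_space M)" and Y': "Y' \<in> sections M (hol_tangent_space M)"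
    and eq: "X' q = X q \<and> Y' q = Y q"
  let ?B = "\<lambda>X Y. lie_bracket M X (\<lambda>p. cconj (Y p)) q"
  have "?B X Y - ?B X' Y' = antihol_vec (dbar Y q (fst (X q)) - dbar Y' q (fst (X q)))
     - hol_vec (dbar X q (fst (Y q)) - dbar X' q (fst (Y q)))"
    by (simp add: lie_bracket_hol[OF X Y q] lie_bracket_hol[OF X' Y' q] eq hol_vec_diff antihol_vec_diff)
  also have "\<dots> \<in> hol_tangent_space M q + antihol_tangent_space M q"
    using section_hol_vec(2)[OF X q] section_hol_vec(2)[OF Y q]
    by (simp add: hol_antihol_mem_sum q vdot_diff_right vdot_dbar X Y X' Y' eq)
  finally show "cscale (\<i> / 2) (?B X Y) +o (hol_tangent_space M q + antihol_tangent_space M q)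
     = cscale (\<i> / 2) (?B X' Y') +o (hol_tangent_space M q + antihol_tangent_space M q)"
    unfolding sum_coset_eq_iff[OF q] cplxn.scale_right_diff_distrib[symmetric]
    by (intro sum_subspace(2)[OF q])
next
  fix l assume "\<forall>X'\<in>sections M (hol_tangent_space M). \<forall>Y'\<in>sections M (hol_tangent_space M).
     X' q = X q \<and> Y' q = Y q \<longrightarrow> l = cscale (\<i> / 2) (lie_bracket M X' (\<lambda>p. cconj (Y' p)) q)
        +o (hol_tangent_space M q + antihol_tangent_space M q)"
  then show "l = cscale (\<i> / 2) (lie_bracket M X (\<lambda>p. cconj (Y p)) q)
     +o (hol_tangent_space M q + antihol_tangent_space M q)"
    using X Y by blast
qed

text \<open>The coset is zero iff \<open>\<nu>\<close> annihilates both the (1,0) and the (0,1) part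
  of the bracket. No symmetry of \<open>d\<nu>\<close> is assumed in this locale, so both conditions
  stay.\<close>

lemma levi_form_zero_iff:
  assumes q: "q \<in> M" and "vdot (\<nu> q) a = 0" "vdot (\<nu> q) b = 0"
  shows "levi_form M q (hol_vec a) (hol_vec b) = hol_tangent_space M q + antihol_tangent_space M q
    \<longleftrightarrow> vdot (d\<nu> q (vcnj b)) a = 0 \<and> vdot (d\<nu> q (vcnj a)) b = 0"
proof -
  obtain X where X: "X \<in> sections M (hol_tangent_space M)" "X q = hol_vec a"
    using section_through[OF q, of "hol_vec a"] assms by auto
  obtain Y where Y: "Y \<in> sections M (hol_tangent_space M)" "Y q = hol_vec b"
    using section_through[OF q, of "hol_vec b"] assms by auto
  let ?S = "hol_tangent_space M q + antihol_tangent_space M q"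
  let ?L = "lie_bracket M X (\<lambda>p. cconj (Y p)) q"
  have "levi_form M q (hol_vec a) (hol_vec b) = cscale (\<i> / 2) ?L +o ?S"
    using levi_form_eq[OF X(1) Y(1) q] X Y by simp
  moreover have "cscale (\<i> / 2) ?L +o ?S = ?S \<longleftrightarrow> cscale (\<i> / 2) ?L \<in> ?S"
    using sum_coset_eq_iff[OF q, of "cscale (\<i> / 2) ?L" 0] by (simp add: set_zero_plus)
  \<comment> \<open>The factor i/2 is inverted by - 2 i.\<close>
  moreover have "cscale (\<i> / 2) ?L \<in> ?S \<longleftrightarrow> ?L \<in> ?S"
    using sum_subspace(2)[OF q, of ?L ?L "\<i> / 2"] sum_subspace(2)[OF q, of "cscale (\<i> / 2) ?L" "cscale (\<i> / 2) ?L" "- 2 * \<i>"]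
    by auto
  moreover have "?L \<in> ?S \<longleftrightarrow> vdot (d\<nu> q (vcnj b)) a = 0 \<and> vdot (d\<nu> q (vcnj a)) b = 0"
    using assms by (simp add: lie_bracket_hol[OF X(1) Y(1) q] hol_antihol_mem_sum[OF q] X(2) Y(2)
        vdot_dbar[OF X(1) q] vdot_dbar[OF Y(1) q])
  ultimately show ?thesis by simp
qed

lemma mem_levi_kernel:
  assumes "q \<in> M"
  shows "V \<in> levi_kernel M q \<longleftrightarrow> (\<exists>a. V = hol_vec a \<and> vdot (\<nu> q) a = 0 \<and>
    (\<forall>b. vdot (\<nu> q) b = 0 \<longrightarrow> vdot (d\<nu> q (vcnj b)) a = 0 \<and> vdot (d\<nu> q (vcnj a)) b = 0))"
proof -
  have "hol_vec a \<in> levi_kernel M q \<longleftrightarrow> (\<forall>b. vdot (\<nu> q) b = 0 \<longrightarrow>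
      vdot (d\<nu> q (vcnj b)) a = 0 \<and> vdot (d\<nu> q (vcnj a)) b = 0)" if "vdot (\<nu> q) a = 0" for a
  proof -
    have "hol_vec a \<in> levi_kernel M q \<longleftrightarrow> (\<forall>b. vdot (\<nu> q) b = 0 \<longrightarrow>
      levi_form M q (hol_vec a) (hol_vec b) = hol_tangent_space M q + antihol_tangent_space M q)"
      unfolding levi_kernel_def mem_Collect_eq Ball_def mem_hol[OF assms] using that by blast
    then show ?thesis using levi_form_zero_iff[OF assms that] by simp
  qed
  moreover have "V \<in> levi_kernel M q \<Longrightarrow> \<exists>a. V = hol_vec a \<and> vdot (\<nu> q) a = 0"
    unfolding levi_kernel_def mem_Collect_eq mem_hol[OF assms] by blast
  ultimately show ?thesis by blast
qed

end

section \<open>One-dimensional Levi kernels and their adjoint operators\<close>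

text \<open>\<open>w\<close> is a real kernel direction, normalised by coordinate \<open>m\<close>.
  \<open>dw_w\<close> and \<open>dnu_w\<close> say that \<open>w\<close> and the conormal
  \<open>\<nu>\<close> do not change in this direction, \<open>nu_dw\<close> that derivatives of
  \<open>w\<close> stay in H; \<open>kernel\<close> bounds the Levi kernel from above.\<close>

locale tube_form_kernel = tube_form M k\<^sub>0 \<nu> d\<nu>
  for M :: "(complex ^ 'i::finite) set" and k\<^sub>0 \<nu> d\<nu> +
  fixes m :: 'i and w :: "complex ^ 'i \<Rightarrow> complex ^ 'i" and dw :: "complex ^ 'i \<Rightarrow> complex ^ 'i \<Rightarrow> complex ^ 'i"
  assumes w_deriv: "q \<in> M \<Longrightarrow> (w has_derivative (\<lambda>u. dw q (vre u))) (at q within M)"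
    and dw_linear: "Vector_Spaces.linear (*s) (*s) (dw q)"
    and w_m: "w q $ m = 1"
    and w_real: "vcnj (w q) = w q"
    and dw_w: "dw q (w q) = 0"
    and nu_w: "vdot (\<nu> q) (w q) = 0"
    and nu_dw: "vdot (\<nu> q) (dw q u) = 0"
    and dnu_w: "d\<nu> q (w q) = 0"
    and dnu_vdot_w: "vdot (d\<nu> q u) (w q) = 0"
    and kernel: "\<lbrakk>q \<in> M; vdot (\<nu> q) a = 0; \<And>b. vdot (\<nu> q) b = 0 \<Longrightarrow> vdot (d\<nu> q (vcnj b)) a = 0\<rbrakk>
      \<Longrightarrow> \<exists>c. a = c *s w q"
begin

lemma w_nonzero: "w q \<noteq> 0"
  using w_m[of q] by auto

lemma dw_combine: "dw q (vre u) + \<i> *s dw q (vre (\<i> *s u)) = dw q (vcnj u)"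
  by (simp add: vec.linear_add[OF dw_linear, symmetric] vec.linear_scale[OF dw_linear, symmetric]
      vre_plus_i_vre)

lemma mem_kernel:
  assumes "q \<in> M"
  shows "V \<in> levi_kernel M q \<longleftrightarrow> (\<exists>c. V = hol_vec (c *s w q))"
proof
  assume "V \<in> levi_kernel M q"
  then show "\<exists>c. V = hol_vec (c *s w q)"
    unfolding mem_levi_kernel[OF assms] using kernel[OF assms] by blast
next
  assume "\<exists>c. V = hol_vec (c *s w q)"
  then show "V \<in> levi_kernel M q"
    by (auto simp: mem_levi_kernel[OF assms] vdot_simps nu_w dnu_vdot_w w_real dnu_w
        vec.linear_scale[OF dnu_linear])
qed

lemma dim_levi_kernel:
  assumes "q \<in> M"
  shows "cplxn.dim (levi_kernel M q) = 1"
proof -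
  have "levi_kernel M q = cplxn.span {hol_vec (w q)}"
    unfolding set_eq_iff mem_kernel[OF assms] cplxn.span_singleton by (simp add: image_iff hol_vec_scale)
  moreover have "cplxn.independent {hol_vec (w q)}"
    by (simp add: w_nonzero)
  ultimately show ?thesis
    by (simp add: cplxn.dim_eq_card_independent)
qed

section \<open>Cosets in H/K\<close>

definition levi_coset :: "complex ^ 'i \<Rightarrow> complex ^ 'i \<Rightarrow> (complex ^ 'i) cplxn set" where
  "levi_coset q b = hol_vec b +o levi_kernel M q"

lemma mem_levi_coset:
  assumes "q \<in> M"
  shows "V \<in> levi_coset q b \<longleftrightarrow> (\<exists>c. V = hol_vec (b + c *s w q))"
  unfolding levi_coset_def elt_set_plus_def mem_Collect_eq Bex_def mem_kernel[OF assms] hol_vec_add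
  by blast

lemma levi_coset_eq_iff:
  assumes "q \<in> M"
  shows "levi_coset q a = levi_coset q b \<longleftrightarrow> (\<exists>c. a = b + c *s w q)"
proof
  assume "levi_coset q a = levi_coset q b"
  moreover have "hol_vec a \<in> levi_coset q a"
    unfolding mem_levi_coset[OF assms] by (intro exI[of _ 0]) simp
  ultimately show "\<exists>c. a = b + c *s w q"
    by (simp add: mem_levi_coset[OF assms])
next
  assume "\<exists>c. a = b + c *s w q"
  then obtain c where c: "a = b + c *s w q" ..
  have "(\<exists>d. V = hol_vec (a + d *s w q)) \<longleftrightarrow> (\<exists>d. V = hol_vec (b + d *s w q))" for V
  proof
    assume "\<exists>d. V = hol_vec (a + d *s w q)"
    then obtain d where "V = hol_vec (a + d *s w q)" ..
    then show "\<exists>d. V = hol_vec (b + d *s w q)"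
      by (intro exI[of _ "c + d"]) (simp add: c vec.scale_left_distrib add.assoc)
  next
    assume "\<exists>d. V = hol_vec (b + d *s w q)"
    then obtain d where "V = hol_vec (b + d *s w q)" ..
    then show "\<exists>d. V = hol_vec (a + d *s w q)"
      by (intro exI[of _ "d - c"]) (simp add: c vec.scale_left_diff_distrib)
  qed
  then show "levi_coset q a = levi_coset q b"
    by (auto simp: set_eq_iff mem_levi_coset[OF assms])
qed

lemma levi_coset_zero: "levi_coset q 0 = levi_kernel M q"
  by (simp add: levi_coset_def set_zero_plus)

lemma mem_quotient:
  assumes "q \<in> M"
  shows "\<xi> \<in> quotient_space (hol_tangent_space M q) (levi_kernel M q)
    \<longleftrightarrow> (\<exists>b. \<xi> = levi_coset q b \<and> vdot (\<nu> q) b = 0)"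
  unfolding quotient_space_def levi_coset_def image_iff Bex_def mem_hol[OF assms] by blast

lemma coset_scale_levi_coset:
  assumes "q \<in> M"
  shows "coset_scale (levi_kernel M q) c (levi_coset q b) = levi_coset q (c *s b)"
proof -
  have "V \<in> coset_scale (levi_kernel M q) c (levi_coset q b) \<longleftrightarrow> V \<in> levi_coset q (c *s b)" for V
  proof
    assume "V \<in> coset_scale (levi_kernel M q) c (levi_coset q b)"
    then obtain d e where "V = cscale c (hol_vec (b + d *s w q)) + hol_vec (e *s w q)"
      unfolding coset_scale_def set_plus_def mem_Collect_eq Bex_def image_iff
        mem_levi_coset[OF assms] mem_kernel[OF assms] by blast
    then have "V = hol_vec (c *s b + (c * d + e) *s w q)"
      by (simp add: hol_vec_add hol_vec_scale cplxn.scale_right_distrib cplxn.scale_left_distrib add.assoc)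
    then show "V \<in> levi_coset q (c *s b)" unfolding mem_levi_coset[OF assms] by blast
  next
    assume "V \<in> levi_coset q (c *s b)"
    then obtain d where "V = cscale c (hol_vec b) + hol_vec (d *s w q)"
      by (auto simp: mem_levi_coset[OF assms] hol_vec_add hol_vec_scale)
    moreover have "hol_vec b \<in> levi_coset q b"
      unfolding mem_levi_coset[OF assms] by (intro exI[of _ 0]) simp
    moreover have "hol_vec (d *s w q) \<in> levi_kernel M q" by (auto simp: mem_kernel[OF assms])
    ultimately show "V \<in> coset_scale (levi_kernel M q) c (levi_coset q b)"
      unfolding coset_scale_def by (auto intro!: set_plus_intro)
  qed
  then show ?thesis by blast
qed

section \<open>Adjoint operators computed from sections\<close>

lemma kernel_section_through:
  assumes "q \<in> M"
  obtains V where "V \<in> sections M (levi_kernel M)" "V q = hol_vec (c *s w q)"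
proof -
  have "(\<lambda>p. hol_vec (c *s w p)) differentiable_on M"
    unfolding differentiable_on_def differentiable_def
  proof (intro ballI exI)
    fix p assume p: "p \<in> M"
    show "((\<lambda>p. hol_vec (c *s w p)) has_derivative (\<lambda>u. hol_vec (c *s dw p (vre u)))) (at p within M)"
      by (rule bounded_linear.has_derivative[OF bounded_linear_hol_vec bounded_linear.has_derivative[OF
          bounded_bilinear.bounded_linear_right[OF bounded_bilinear_vector_scalar_mult] w_deriv[OF p]]])
  qed
  then have "(\<lambda>p. hol_vec (c *s w p)) \<in> sections M (levi_kernel M)"
    by (auto simp: sections_def mem_kernel)
  then show ?thesis using that by blast
qed

lemma kernel_section_is_section:
  assumes "V \<in> sections M (levi_kernel M)"
  shows "V \<in> sections M (hol_tangent_space M)"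
  using assms by (auto simp: sections_def levi_kernel_def)

text \<open>\<open>V\<close> is a function times \<open>w\<close>. By the Leibniz rule the
  derivative of the function only adds a multiple of \<open>w\<close>, which the quotient by K
  ignores.\<close>

lemma dbar_kernel_section:
  assumes V: "V \<in> sections M (levi_kernel M)" and q: "q \<in> M" and u: "vdot (\<nu> q) u = 0"
    and c: "V q = hol_vec (c *s w q)"
  shows "\<exists>d. dbar V q u = c *s dw q (vcnj u) + d *s w q"
proof -
  define D where "D = field_deriv V q"
  \<comment> \<open>As \<open>w_m\<close> normalises coordinate \<open>m\<close>, the coefficient
    function is that coordinate of \<open>V\<close> and hence differentiable.\<close>
  have eq: "fst (V p) = (fst (V p) $ m) *s w p" if p: "p \<in> M" for p
  proof -
    have "V p \<in> levi_kernel M p" using V p by (simp add: sections_def)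
    then obtain d where "V p = hol_vec (d *s w p)" by (auto simp: mem_kernel[OF p])
    then show ?thesis by (simp add: w_m)
  qed
  have "((\<lambda>p. fst (V p)) has_derivative D) (at q within M)"
    unfolding D_def by (rule section_has_derivative(2)[OF V q])
  note 1 = bounded_linear.has_derivative[OF bounded_linear_vec_nth[of m] this]
  have c': "fst (V q) $ m = c" by (simp add: c w_m)
  have *: "D v = c *s dw q (vre v) + (D v $ m) *s w q" if "v \<in> tangent_space M q" for v
    using tangent_space_diff_unique[OF that section_has_derivative(2)[OF V q]
        bounded_bilinear.FDERIV[OF bounded_bilinear_vector_scalar_mult 1 w_deriv[OF q]] eq]
    by (simp add: D_def c')
  have t: "u \<in> tangent_space M q" "\<i> *s u \<in> tangent_space M q"
    using u by (simp_all add: tangent[OF q] vdot_simps)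
  have "dbar V q u = D u + \<i> *s D (\<i> *s u)" by (simp add: dbar_def D_def)
  also have "\<dots> = c *s (dw q (vre u) + \<i> *s dw q (vre (\<i> *s u))) + (D u $ m + \<i> * D (\<i> *s u) $ m) *s w q"
    by (subst *[OF t(1)], subst *[OF t(2)])
      (simp add: vec_eq_iff algebra_simps)
  finally show ?thesis unfolding dw_combine by blast
qed

text \<open>The bracket is a (0,1) vector minus a (1,0) vector. The former lies in H' and is
  absorbed, so intersecting with H leaves minus the latter modulo K.\<close>

lemma bracket_coset:
  assumes q: "q \<in> M" and V: "V \<in> sections M (levi_kernel M)" "V q = hol_vec (c *s w q)"
    and X: "X \<in> sections M (hol_tangent_space M)" and b: "X q \<in> levi_coset q b"
  shows "(lie_bracket M V (\<lambda>p. cconj (X p)) q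
      +o (antihol_tangent_space M q + levi_kernel M q)) \<inter> hol_tangent_space M q
    = levi_coset q (- (c *s dw q (vcnj b)))"
proof -
  note V' = kernel_section_is_section[OF V(1)]
  obtain e where e: "X q = hol_vec (b + e *s w q)" using b by (auto simp: mem_levi_coset[OF q])
  have l: "vdot (\<nu> q) (fst (X q)) = 0" by (rule section_hol_vec(2)[OF X q])
  obtain d where "dbar V q (fst (X q)) = c *s dw q (vcnj (fst (X q))) + d *s w q"
    using dbar_kernel_section[OF V(1) q l V(2)] by blast
  \<comment> \<open>Independence of the representative: the extra \<open>e *s w q\<close>
    contributes nothing, since \<open>w\<close> is real and \<open>dw q (w q) = 0\<close>.\<close>
  then have d: "dbar V q (fst (X q)) = c *s dw q (vcnj b) + d *s w q"
    by (simp add: e vec.linear_add[OF dw_linear] vec.linear_scale[OF dw_linear] w_real dw_w)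
  define \<beta> where "\<beta> = dbar X q (fst (V q))"
  \<comment> \<open>Here it matters that \<open>V q\<close> lies in the Levi kernel:
    \<open>d\<nu> q\<close> kills the conjugate of its coefficient vector.\<close>
  have \<beta>: "vdot (\<nu> q) \<beta> = 0" unfolding \<beta>_def
    by (subst vdot_dbar[OF X q])
      (simp_all add: V(2) vdot_simps nu_w w_real vec.linear_scale[OF dnu_linear] dnu_w)
  let ?a = "c *s dw q (vcnj b) + d *s w q"
  have L: "lie_bracket M V (\<lambda>p. cconj (X p)) q = antihol_vec \<beta> - hol_vec ?a"
    unfolding lie_bracket_hol[OF V' X q] d \<beta>_def ..
  have a: "vdot (\<nu> q) ?a = 0" by (simp add: vdot_simps nu_w nu_dw)
  have "U \<in> (lie_bracket M V (\<lambda>p. cconj (X p)) q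
      +o (antihol_tangent_space M q + levi_kernel M q)) \<inter> hol_tangent_space M q
    \<longleftrightarrow> (\<exists>s. U = hol_vec (- ?a + s *s w q))" (is "?l \<longleftrightarrow> ?r") for U
  proof
    assume ?l
    then obtain \<beta>' s u where 1: "U = antihol_vec \<beta> - hol_vec ?a + (antihol_vec \<beta>' + hol_vec (s *s w q))"
      "U = hol_vec u" "vdot (\<nu> q) u = 0"
      unfolding L elt_set_plus_def set_plus_def Int_iff mem_Collect_eq Bex_def mem_hol[OF q]
        mem_antihol[OF q] mem_kernel[OF q] by blast
    then have "hol_vec u + antihol_vec 0 = hol_vec (- ?a + s *s w q) + antihol_vec (\<beta> + \<beta>')"
      by (simp add: hol_vec_add hol_vec_diff hol_vec_minus antihol_vec_add)
    from hol_antihol_eq(1)[OF this] 1(2) show ?r by blast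
  next
    assume ?r
    then obtain s where s: "U = hol_vec (- ?a + s *s w q)" ..
    have "U = antihol_vec \<beta> - hol_vec ?a + (antihol_vec (- \<beta>) + hol_vec (s *s w q))"
      by (simp add: s hol_vec_add hol_vec_diff hol_vec_minus antihol_vec_minus)
    moreover have "antihol_vec (- \<beta>) + hol_vec (s *s w q) \<in> antihol_tangent_space M q + levi_kernel M q"
      using \<beta> by (intro set_plus_intro) (auto simp: mem_antihol[OF q] mem_kernel[OF q] vdot_simps)
    moreover have "U \<in> hol_tangent_space M q"
      using a by (simp add: s q vdot_simps nu_w)
    ultimately show ?l unfolding L by (auto simp: elt_set_plus_def)
  qed
  then have "(lie_bracket M V (\<lambda>p. cconj (X p)) q
      +o (antihol_tangent_space M q + levi_kernel M q)) \<inter> hol_tangent_space M q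
    = levi_coset q (- ?a)"
    unfolding set_eq_iff mem_levi_coset[OF q] by blast
  also have "\<dots> = levi_coset q (- (c *s dw q (vcnj b)))"
    unfolding levi_coset_eq_iff[OF q] by (intro exI[of _ "- d"]) simp
  finally show ?thesis .
qed

lemma levi_adjoint_eq:
  assumes q: "q \<in> M" and b: "vdot (\<nu> q) b = 0"
  shows "levi_adjoint M q (hol_vec (c *s w q)) (levi_coset q b) = levi_coset q (- (c *s dw q (vcnj b)))"
proof -
  have m: "levi_coset q b \<in> quotient_space (hol_tangent_space M q) (levi_kernel M q)"
    using b by (auto simp: mem_quotient[OF q])
  \<comment> \<open>Without sections through the given vectors the condition under
    \<open>THE\<close> would be vacuous; uniqueness rests on exhibiting such a pair.\<close>
  obtain V where V: "V \<in> sections M (levi_kernel M)" "V q = hol_vec (c *s w q)"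
    using kernel_section_through[OF q] by blast
  obtain X where X: "X \<in> sections M (hol_tangent_space M)" "X q = hol_vec b"
    using section_through[OF q] b q by (metis hol_vec_mem_hol)
  have Xb: "X q \<in> levi_coset q b"
    unfolding X(2) mem_levi_coset[OF q] by (intro exI[of _ 0]) simp
  show ?thesis
    unfolding levi_adjoint_def restrict_apply'[OF m]
  proof (rule the_equality, intro ballI impI)
    fix V' X' assume "V' \<in> sections M (levi_kernel M)" "X' \<in> sections M (hol_tangent_space M)"
      "V' q = hol_vec (c *s w q) \<and> X' q \<in> levi_coset q b"
    then show "levi_coset q (- (c *s dw q (vcnj b)))
      = (lie_bracket M V' (\<lambda>p. cconj (X' p)) q
        +o (antihol_tangent_space M q + levi_kernel M q)) \<inter> hol_tangent_space M q"
      by (intro bracket_coset[symmetric] q) auto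
  next
    fix \<eta> assume "\<forall>V\<in>sections M (levi_kernel M). \<forall>X\<in>sections M (hol_tangent_space M).
      V q = hol_vec (c *s w q) \<and> X q \<in> levi_coset q b \<longrightarrow>
      \<eta> = (lie_bracket M V (\<lambda>p. cconj (X p)) q
        +o (antihol_tangent_space M q + levi_kernel M q)) \<inter> hol_tangent_space M q"
    then show "\<eta> = levi_coset q (- (c *s dw q (vcnj b)))"
      using bracket_coset[OF q V X(1) Xb] V X(1) Xb by blast
  qed
qed

section \<open>From a map on coefficient vectors to operators on H/K\<close>

text \<open>The adjoint operator of \<open>hol_vec (w q)\<close> lifted to coefficient vectors;
  \<open>vcnj\<close> makes it antilinear.\<close>

definition adjoint_generator :: "complex ^ 'i \<Rightarrow> complex ^ 'i \<Rightarrow> complex ^ 'i" where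
  "adjoint_generator q b = - dw q (vcnj b)"

lemma levi_adjoint_generator:
  assumes "q \<in> M" "vdot (\<nu> q) b = 0"
  shows "levi_adjoint M q (hol_vec (c *s w q)) (levi_coset q b) = levi_coset q (c *s adjoint_generator q b)"
  using levi_adjoint_eq[OF assms] by (simp add: adjoint_generator_def)

lemma vdot_adjoint_generator: "vdot (\<nu> q) (adjoint_generator q b) = 0"
  by (simp add: adjoint_generator_def vdot_simps nu_dw)

text \<open>K is a line, so a single \<open>b\<close> not sent into K tells the multiples of
  \<open>w q\<close> apart.\<close>

lemma inj_on_levi_adjoint:
  assumes q: "q \<in> M" and b: "vdot (\<nu> q) b = 0" "\<nexists>c. adjoint_generator q b = c *s w q"
  shows "inj_on (levi_adjoint M q) (levi_kernel M q)"
proof (rule inj_onI)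
  fix v v' assume "v \<in> levi_kernel M q" "v' \<in> levi_kernel M q"
    and eq: "levi_adjoint M q v = levi_adjoint M q v'"
  then obtain c c' where c: "v = hol_vec (c *s w q)" "v' = hol_vec (c' *s w q)"
    by (auto simp: mem_kernel[OF q])
  have "levi_coset q (c *s adjoint_generator q b) = levi_coset q (c' *s adjoint_generator q b)"
    using fun_cong[OF eq, of "levi_coset q b"] by (simp add: c levi_adjoint_generator[OF q b(1)])
  then obtain d where d: "c *s adjoint_generator q b = c' *s adjoint_generator q b + d *s w q"
    by (auto simp: levi_coset_eq_iff[OF q])
  have "c = c'"
  proof (rule ccontr)
    assume ne: "c \<noteq> c'"
    have "(c - c') *s adjoint_generator q b = d *s w q"
      using d by (simp add: vec.scale_left_diff_distrib)
    then have "adjoint_generator q b = (d / (c - c')) *s w q"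
      using ne by (simp add: vec_eq_iff field_simps)
    with b(2) show False by blast
  qed
  then show "v = v'" by (simp add: c)
qed

text \<open>The witness is the adjoint operator of \<open>w q\<close> itself. \<open>ker\<close>
  allows the value \<open>c *s w q\<close> and not just 0 because the kernel on H/K comes from the
  preimage of K. The operator is antilinear, yet its eigenspace for 0 is a complex subspace.\<close>

lemma nilpotent_adjoint_operator:
  fixes q
  defines "H \<equiv> hol_tangent_space M q" and "K \<equiv> levi_kernel M q"
  assumes q: "q \<in> M"
    and nilp: "\<And>b. (adjoint_generator q ^^ N) b = 0"
    and z: "vdot (\<nu> q) z = 0" "adjoint_generator q z = 0" "\<nexists>c. z = c *s w q"
    and ker: "\<And>b c. \<lbrakk>vdot (\<nu> q) b = 0; adjoint_generator q b = c *s w q\<rbrakk>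
      \<Longrightarrow> \<exists>d e. b = d *s z + e *s w q"
  shows "\<exists>A \<in> quotient_space H K \<rightarrow> quotient_space H K. nilpotent_operator H K A
    \<and> one_dimensional H K (eigenspace H K A 0) \<and> levi_adjoint M q ` K = operator_span H K A"
proof (intro bexI conjI)
  let ?A = "levi_adjoint M q (hol_vec (w q))"
  have mQ: "\<xi> \<in> quotient_space H K \<longleftrightarrow> (\<exists>b. \<xi> = levi_coset q b \<and> vdot (\<nu> q) b = 0)" for \<xi>
    unfolding H_def K_def by (rule mem_quotient[OF q])
  have A: "?A (levi_coset q b) = levi_coset q (adjoint_generator q b)" if "vdot (\<nu> q) b = 0" for b
    using levi_adjoint_generator[OF q that, of 1] by simp
  have scale: "coset_scale K c (levi_coset q b) = levi_coset q (c *s b)" for c b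
    unfolding K_def by (rule coset_scale_levi_coset[OF q])
  have zero: "levi_coset q b = K \<longleftrightarrow> (\<exists>c. b = c *s w q)" for b
    using levi_coset_eq_iff[OF q, of b 0] by (simp add: levi_coset_zero K_def)
  show "?A \<in> quotient_space H K \<rightarrow> quotient_space H K"
  proof
    fix \<xi> assume "\<xi> \<in> quotient_space H K"
    then obtain b where "\<xi> = levi_coset q b" "vdot (\<nu> q) b = 0" by (auto simp: mQ)
    then show "?A \<xi> \<in> quotient_space H K"
      using A[of b] vdot_adjoint_generator[of q b] unfolding mQ by metis
  qed
  have pow: "vdot (\<nu> q) ((adjoint_generator q ^^ k) b) = 0
    \<and> (?A ^^ k) (levi_coset q b) = levi_coset q ((adjoint_generator q ^^ k) b)"
    if "vdot (\<nu> q) b = 0" for k b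
    by (induction k) (use that in \<open>auto simp: A vdot_adjoint_generator\<close>)
  have "(?A ^^ N) \<xi> = K" if \<xi>: "\<xi> \<in> quotient_space H K" for \<xi>
  proof -
    obtain b where "\<xi> = levi_coset q b" "vdot (\<nu> q) b = 0" using \<xi> by (auto simp: mQ)
    then show ?thesis using pow[of b N] by (simp add: nilp levi_coset_zero K_def)
  qed
  then show "nilpotent_operator H K ?A"
    unfolding nilpotent_operator_def by blast
  have "eigenspace H K ?A 0 = {coset_scale K c (levi_coset q z) | c. True}"
  proof (intro equalityI subsetI)
    fix \<xi> assume "\<xi> \<in> eigenspace H K ?A 0"
    then obtain b where b: "\<xi> = levi_coset q b" "vdot (\<nu> q) b = 0"
      "levi_coset q (adjoint_generator q b) = levi_coset q 0"
      by (auto simp: eigenspace_def mQ A scale)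
    then obtain c where "adjoint_generator q b = c *s w q"
      by (auto simp: levi_coset_eq_iff[OF q])
    from ker[OF b(2) this] obtain d e where "b = d *s z + e *s w q" by blast
    then have "\<xi> = levi_coset q (d *s z)" unfolding b(1) levi_coset_eq_iff[OF q] by blast
    then show "\<xi> \<in> {coset_scale K c (levi_coset q z) | c. True}" by (auto simp: scale)
  next
    fix \<xi> assume "\<xi> \<in> {coset_scale K c (levi_coset q z) | c. True}"
    then obtain c where c: "\<xi> = levi_coset q (c *s z)" by (auto simp: scale)
    have "vdot (\<nu> q) (c *s z) = 0" by (simp add: vdot_simps z)
    moreover have "adjoint_generator q (c *s z) = 0"
      using z(2) by (simp add: adjoint_generator_def vec.linear_scale[OF dw_linear])
    ultimately show "\<xi> \<in> eigenspace H K ?A 0"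
      by (auto simp: eigenspace_def mQ c A scale)
  qed
  moreover have "levi_coset q z \<in> quotient_space H K" using z(1) by (auto simp: mQ)
  moreover have "levi_coset q z \<noteq> K" using z(3) by (simp add: zero)
  ultimately show "one_dimensional H K (eigenspace H K ?A 0)"
    unfolding one_dimensional_def by blast
  \<comment> \<open>An equality of functions: outside H/K both sides are \<open>undefined\<close> by
    restriction.\<close>
  have eq: "levi_adjoint M q (hol_vec (c *s w q)) = (\<lambda>\<xi>\<in>quotient_space H K. coset_scale K c (?A \<xi>))" for c
  proof
    fix \<xi>
    show "levi_adjoint M q (hol_vec (c *s w q)) \<xi> = (\<lambda>\<xi>\<in>quotient_space H K. coset_scale K c (?A \<xi>)) \<xi>"
    proof (cases "\<xi> \<in> quotient_space H K")
      case True
      then obtain b where "\<xi> = levi_coset q b" "vdot (\<nu> q) b = 0" by (auto simp: mQ)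
      with True show ?thesis by (simp add: levi_adjoint_generator[OF q] A scale)
    next
      case False
      then show ?thesis by (simp add: levi_adjoint_def H_def K_def)
    qed
  qed
  have "K = range (\<lambda>c. hol_vec (c *s w q))"
    unfolding K_def set_eq_iff mem_kernel[OF q] image_iff by blast
  then have "levi_adjoint M q ` K = range (\<lambda>c. levi_adjoint M q (hol_vec (c *s w q)))"
    by (simp add: image_image)
  then show "levi_adjoint M q ` K = operator_span H K ?A"
    unfolding operator_span_def eq by (simp add: full_SetCompr_eq)
qed

end

section \<open>The hypersurfaces\<close>

lemma has_derivative_vec_lambda:
  fixes f :: "'i::finite \<Rightarrow> 'a::real_normed_vector \<Rightarrow> complex"
  assumes "\<And>i. (f i has_derivative f' i) (at p within S)"
  shows "((\<lambda>p. \<chi> i. f i p) has_derivative (\<lambda>u. \<chi> i. f' i u)) (at p within S)"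
proof -
  have *: "(\<chi> i. g i) = (\<Sum>i\<in>UNIV. g i *s axis i 1)" for g :: "'i \<Rightarrow> complex"
    by (simp add: vec_eq_iff axis_def if_distrib cong: if_cong)
  show ?thesis
    unfolding *
    by (intro has_derivative_sum assms bounded_linear.has_derivative[OF
        bounded_bilinear.bounded_linear_left[OF bounded_bilinear_vector_scalar_mult]])
qed

lemma bounded_linear_vre_nth: "bounded_linear (\<lambda>p. vre p $ i)"
  unfolding vre_nth
  by (rule bounded_linear_compose[OF bounded_linear_of_real bounded_linear_Re_vec_nth])

lemma sum_reflect: "(\<Sum>k\<in>{1..<n}. h (n - k)) = (\<Sum>k\<in>{1..<n}. h k)" for n :: nat
  by (rule sum.reindex_bij_witness[of _ "\<lambda>k. n - k" "\<lambda>k. n - k"]) auto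

lemma sum_lessThan_eq_from_1:
  fixes h :: "nat \<Rightarrow> 'a::comm_monoid_add"
  assumes "h 0 = 0"
  shows "(\<Sum>k<n. h k) = (\<Sum>k\<in>{1..<n}. h k)"
  by (rule sum.mono_neutral_right) (use assms in \<open>auto simp: not_less_eq_eq\<close>)

locale hypersurface_data =
  fixes n :: nat and f :: "real \<Rightarrow> real" and e :: "nat \<Rightarrow> 'i::finite"
  assumes n: "n > 2" and e: "bij_betw e {0..n} (UNIV :: 'i set)"
    and f: "\<forall>x. f differentiable (at x)" and df: "\<forall>x. deriv f differentiable (at x)"
begin

abbreviation M :: "(complex ^ 'i) set" where "M \<equiv> hypersurface n e f"

definition coords :: "(nat \<Rightarrow> complex) \<Rightarrow> complex ^ 'i" where
  "coords h = (\<chi> i. h (inv_into {0..n} e i))"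

lemma coords_nth [simp]: "k \<le> n \<Longrightarrow> coords h $ e k = h k"
  using e by (simp add: coords_def bij_betw_def inv_into_f_f)

lemma e_eq_iff [simp]: "\<lbrakk>j \<le> n; k \<le> n\<rbrakk> \<Longrightarrow> e j = e k \<longleftrightarrow> j = k"
  using e by (auto simp: bij_betw_def inj_on_def)

lemma vec_eqI: "(\<And>k. k \<le> n \<Longrightarrow> u $ e k = v $ e k) \<Longrightarrow> u = (v :: complex ^ 'i)"
proof -
  assume *: "\<And>k. k \<le> n \<Longrightarrow> u $ e k = v $ e k"
  have "u $ i = v $ i" for i
  proof -
    have "i \<in> e ` {0..n}" using e by (simp add: bij_betw_def)
    then show ?thesis using * by auto
  qed
  then show ?thesis by (simp add: vec_eq_iff)
qed

lemma vdot_e: "vdot u v = u $ e 0 * v $ e 0 + (\<Sum>k\<in>{1..<n}. u $ e k * v $ e k) + u $ e n * v $ e n"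
proof -
  have "vdot u v = (\<Sum>k\<in>{0..n}. u $ e k * v $ e k)"
    unfolding vdot_def by (rule sum.reindex_bij_betw[OF e, symmetric])
  also have "{0..n} = insert 0 (insert n {1..<n})" using n by auto
  finally show ?thesis using n by simp
qed

lemma has_derivative_coords:
  assumes "\<And>k. k \<le> n \<Longrightarrow> ((\<lambda>p. h p k) has_derivative (\<lambda>u. h' u k)) (at p within S)"
  shows "((\<lambda>p. coords (h p)) has_derivative (\<lambda>u. coords (h' u))) (at p within S)"
  unfolding coords_def
proof (rule has_derivative_vec_lambda)
  fix i
  have "inv_into {0..n} e i \<le> n"
    using inv_into_into[of i e "{0..n}"] e by (auto simp: bij_betw_def)
  then show "((\<lambda>p. h p (inv_into {0..n} e i)) has_derivative (\<lambda>u. h' u (inv_into {0..n} e i))) (at p within S)"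
    by (rule assms)
qed

section \<open>The leaf invariants, the gradient and its derivative\<close>

text \<open>With \<open>t = x\<^sub>n\<close>, \<open>y\<^sub>k\<close> is the sum of the \<open>t ^ (k - j) * x\<^sub>j\<close> over \<open>1 \<le> j \<le> k\<close>. The \<open>y\<^sub>k\<close> with \<open>k < n\<close>
  are constant along the leaves of the Levi foliation.\<close>

primrec y :: "complex ^ 'i \<Rightarrow> nat \<Rightarrow> complex" where
  "y p 0 = 0"
| "y p (Suc k) = vre p $ e (Suc k) + vre p $ e n * y p k"

text \<open>The complex linear extension of the derivative of \<open>y\<close>; inserting
  \<open>vre u\<close> gives the actual derivative in the direction \<open>u\<close>.\<close>

primrec dy :: "complex ^ 'i \<Rightarrow> complex ^ 'i \<Rightarrow> nat \<Rightarrow> complex" where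
  "dy p u 0 = 0"
| "dy p u (Suc k) = u $ e (Suc k) + u $ e n * y p k + vre p $ e n * dy p u k"

lemma y_deriv: "((\<lambda>p. y p k) has_derivative (\<lambda>u. dy p (vre u) k)) (at p within S)"
proof (induction k)
  case (Suc k)
  note 1 = bounded_linear_imp_has_derivative[OF bounded_linear_vre_nth]
  show ?case
    unfolding y.simps dy.simps
    by (rule has_derivative_eq_rhs, rule has_derivative_add[OF 1 has_derivative_mult[OF 1 Suc]])
      (simp add: algebra_simps)
qed simp

lemma y_real: "cnj (y p k) = y p k"
  by (induction k) auto

lemma dy_add: "dy p (u + v) k = dy p u k + dy p v k"
  by (induction k) (auto simp: algebra_simps)

lemma dy_scale: "dy p (c *s u) k = c * dy p u k"
  by (induction k) (auto simp: algebra_simps)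

text \<open>Obtained from d(XY) = 2 Y dX + s Y^2 dt at order s^n; \<open>f\<close> contributes to
  the first coordinate only.\<close>

definition grad :: "complex ^ 'i \<Rightarrow> nat \<Rightarrow> complex" where
  "grad p k = (if k = n then \<Sum>j<n. y p j * y p (n - Suc j)
     else 2 * y p (n - k) + (if k = 1 then of_real (deriv f (Re (p $ e 1))) else 0))"

definition dgrad :: "complex ^ 'i \<Rightarrow> complex ^ 'i \<Rightarrow> nat \<Rightarrow> complex" where
  "dgrad p u k = (if k = n then 2 * (\<Sum>j<n. dy p u j * y p (n - Suc j))
     else 2 * dy p u (n - k) + (if k = 1 then of_real (deriv (deriv f) (Re (p $ e 1))) * u $ e 1 else 0))"

lemma grad_real: "cnj (grad p k) = grad p k"
  by (simp add: grad_def y_real)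

lemma dgrad_add: "dgrad p (u + v) k = dgrad p u k + dgrad p v k"
  by (simp add: dgrad_def dy_add algebra_simps sum.distrib)

lemma dgrad_scale: "dgrad p (c *s u) k = c * dgrad p u k"
  by (simp add: dgrad_def dy_scale algebra_simps sum_distrib_left)

lemma sum_flip: "(\<Sum>j<n. a j * b (n - Suc j)) = (\<Sum>j<n. b j * a (n - Suc j))"
  for a b :: "nat \<Rightarrow> complex"
proof -
  have "(\<Sum>j<n. a j * b (n - Suc j)) = (\<Sum>j<n. a (n - Suc j) * b (n - Suc (n - Suc j)))"
    by (rule sum.nat_diff_reindex[symmetric])
  also have "\<dots> = (\<Sum>j<n. b j * a (n - Suc j))"
    by (rule sum.cong) (auto simp: mult.commute)
  finally show ?thesis .
qed

lemma deriv_f_comp: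
  assumes "\<forall>x. g differentiable (at x)"
  shows "((\<lambda>p. g (Re (p $ i))) has_derivative (\<lambda>u. deriv g (Re (p $ i)) * Re (u $ i)))
    (at (p :: complex ^ 'i) within S)"
proof -
  have "(g has_derivative (*) (deriv g x)) (at x)" for x
    using assms by (metis DERIV_deriv_iff_real_differentiable has_field_derivative_def)
  from has_derivative_compose[OF bounded_linear_imp_has_derivative[OF bounded_linear_Re_vec_nth] this]
  show ?thesis .
qed

lemma grad_deriv: "((\<lambda>p. grad p k) has_derivative (\<lambda>u. dgrad p (vre u) k)) (at p within S)"
proof (cases "k = n")
  case True
  have "((\<lambda>p. \<Sum>j<n. y p j * y p (n - Suc j)) has_derivative
      (\<lambda>u. \<Sum>j<n. y p j * dy p (vre u) (n - Suc j) + dy p (vre u) j * y p (n - Suc j))) (at p within S)"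
    by (intro has_derivative_sum has_derivative_mult y_deriv)
  moreover have "(\<Sum>j<n. y p j * dy p (vre u) (n - Suc j) + dy p (vre u) j * y p (n - Suc j))
     = dgrad p (vre u) n" for u
    using sum_flip[of "y p" "dy p (vre u)"] by (simp add: dgrad_def sum.distrib)
  ultimately show ?thesis using True by (simp add: grad_def)
next
  case False
  have 1: "((\<lambda>p. of_real (deriv f (Re (p $ e 1)))) has_derivative
    (\<lambda>u. of_real (deriv (deriv f) (Re (p $ e 1)) * Re (u $ e 1)) :: complex)) (at p within S)"
    by (rule bounded_linear.has_derivative[OF bounded_linear_of_real deriv_f_comp[OF df]])
  have 2: "((\<lambda>p. 2 * y p (n - k)) has_derivative (\<lambda>u. 2 * dy p (vre u) (n - k))) (at p within S)"
    by (rule bounded_linear.has_derivative[OF bounded_linear_mult_right y_deriv])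
  show ?thesis
    using has_derivative_add[OF 2 1] 2 False by (cases "k = 1") (simp_all add: grad_def dgrad_def)
qed

section \<open>The graph function, its differential and the tangent space\<close>

text \<open>The quadratic form regrouped as the coefficient of s^n in X Y; the end terms vanish
  because X and Y have no constant term.\<close>

definition graph_fun :: "complex ^ 'i \<Rightarrow> real" where
  "graph_fun p = f (Re (p $ e 1)) + Re (\<Sum>k\<in>{1..<n}. vre p $ e (n - k) * y p k)"

lemma y_eq_sum: "y p k = of_real (\<Sum>j\<in>{1..k}. Re (p $ e j) * Re (p $ e n) ^ (k - j))"
proof (induction k)
  case (Suc k)
  have "(\<Sum>j\<in>{1..k}. Re (p $ e j) * Re (p $ e n) ^ (Suc k - j))
     = Re (p $ e n) * (\<Sum>j\<in>{1..k}. Re (p $ e j) * Re (p $ e n) ^ (k - j))"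
    unfolding sum_distrib_left by (rule sum.cong) (auto simp: Suc_diff_le)
  then show ?case using Suc by simp
qed simp

lemma hypersurface_eq: "M = {p. Re (p $ e 0) = graph_fun p}"
proof -
  have "(\<Sum>(j, k) \<in> {(j, k). 0 < j \<and> j < j + k \<and> j + k \<le> n}. x j * x k * t ^ (n - j - k))
    = (\<Sum>k\<in>{1..<n}. x (n - k) * (\<Sum>j\<in>{1..k}. x j * t ^ (k - j)))" for x :: "nat \<Rightarrow> real" and t
  proof -
    have "(\<Sum>k\<in>{1..<n}. x (n - k) * (\<Sum>j\<in>{1..k}. x j * t ^ (k - j)))
      = (\<Sum>(k, j)\<in>Sigma {1..<n} (\<lambda>k. {1..k}). x (n - k) * (x j * t ^ (k - j)))"
      by (simp add: sum_distrib_left sum.Sigma)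
    \<comment> \<open>A pair (j, k) goes to row \<open>n - k\<close> with inner index
      \<open>j\<close>, and the exponent (n - k) - j matches.\<close>
    also have "\<dots> = (\<Sum>(j, k) \<in> {(j, k). 0 < j \<and> j < j + k \<and> j + k \<le> n}. x j * x k * t ^ (n - j - k))"
      by (rule sum.reindex_bij_witness[of _ "\<lambda>(j, k). (n - k, j)" "\<lambda>(k, j). (j, n - k)"])
        (auto simp: algebra_simps)
    finally show ?thesis ..
  qed
  then show ?thesis
    unfolding hypersurface_def Let_def graph_fun_def y_eq_sum by simp
qed

text \<open>From X = (1 - t s) Y one gets dX = (1 - t s) dY - s Y dt, so X dY = Y dX + s Y^2 dt.
  Adding Y dX and reading off s^n gives the claim.\<close>

lemma graph_fun_derivative_identity:
  "(\<Sum>k\<in>{1..<n}. vre p $ e (n - k) * dy p u k + u $ e (n - k) * y p k)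
    = (\<Sum>k\<in>{1..<n}. 2 * y p (n - k) * u $ e k) + (\<Sum>j<n. y p j * y p (n - Suc j)) * u $ e n"
proof -
  let ?t = "vre p $ e n"
  have r: "(\<Sum>k\<in>{1..<n}. y p (n - k) * u $ e k) = (\<Sum>k\<in>{1..<n}. u $ e (n - k) * y p k)"
    by (subst sum_reflect[symmetric]) (auto intro!: sum.cong)
  \<comment> \<open>The recursions of \<open>y\<close> and \<open>dy\<close> solved for the
    coordinate; \<open>n - Suc k\<close> is the predecessor of \<open>n - k\<close> as
    \<open>k < n\<close>.\<close>
  have x: "vre p $ e (n - k) = y p (n - k) - ?t * y p (n - Suc k)"
    and ux: "u $ e (n - k) = dy p u (n - k) - u $ e n * y p (n - Suc k) - ?t * dy p u (n - Suc k)"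
    if "k < n" for k
    using that by (auto simp: Suc_diff_Suc[symmetric])
  have 1: "(\<Sum>k\<in>{1..<n}. y p (n - k) * dy p u k) = (\<Sum>k\<in>{1..<n}. dy p u (n - k) * y p k)"
    by (subst sum_reflect[symmetric]) (auto intro!: sum.cong)
  have 2: "(\<Sum>k\<in>{1..<n}. y p (n - Suc k) * dy p u k) = (\<Sum>k\<in>{1..<n}. dy p u (n - Suc k) * y p k)"
    using sum_flip[of "dy p u" "y p"]
    by (simp add: sum_lessThan_eq_from_1 mult.commute)
  have 3: "(\<Sum>k<n. y p k * y p (n - Suc k)) = (\<Sum>k\<in>{1..<n}. y p (n - Suc k) * y p k)"
    by (simp add: sum_lessThan_eq_from_1 mult.commute)
  have h1: "(\<Sum>k\<in>{1..<n}. vre p $ e (n - k) * dy p u k)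
     = (\<Sum>k\<in>{1..<n}. y p (n - k) * dy p u k) - ?t * (\<Sum>k\<in>{1..<n}. y p (n - Suc k) * dy p u k)"
    unfolding sum_distrib_left sum_subtractf[symmetric]
    by (rule sum.cong) (simp_all add: x algebra_simps del: vre_nth)
  have h2: "(\<Sum>k\<in>{1..<n}. u $ e (n - k) * y p k) = (\<Sum>k\<in>{1..<n}. dy p u (n - k) * y p k)
     - u $ e n * (\<Sum>k\<in>{1..<n}. y p (n - Suc k) * y p k) - ?t * (\<Sum>k\<in>{1..<n}. dy p u (n - Suc k) * y p k)"
    unfolding sum_distrib_left sum_subtractf[symmetric]
    by (rule sum.cong) (simp_all add: ux algebra_simps del: vre_nth)
  have "(\<Sum>k\<in>{1..<n}. vre p $ e (n - k) * dy p u k) = (\<Sum>k\<in>{1..<n}. u $ e (n - k) * y p k)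
     + (\<Sum>k<n. y p k * y p (n - Suc k)) * u $ e n"
    unfolding h1 h2 1 2 3 by (simp add: algebra_simps)
  moreover have "(\<Sum>k\<in>{1..<n}. 2 * y p (n - k) * u $ e k) = 2 * (\<Sum>k\<in>{1..<n}. y p (n - k) * u $ e k)"
    by (simp add: sum_distrib_left mult.assoc)
  ultimately show ?thesis using r by (simp add: sum.distrib)
qed

definition grad_dot :: "complex ^ 'i \<Rightarrow> complex ^ 'i \<Rightarrow> complex" where
  "grad_dot p u = (\<Sum>k\<in>{1..<n}. grad p k * u $ e k) + grad p n * u $ e n"

lemma grad_dot_eq:
  "grad_dot p u = of_real (deriv f (Re (p $ e 1))) * u $ e 1
    + (\<Sum>k\<in>{1..<n}. vre p $ e (n - k) * dy p u k + u $ e (n - k) * y p k)"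
proof -
  have "(\<Sum>k\<in>{1..<n}. grad p k * u $ e k) = (\<Sum>k\<in>{1..<n}. 2 * y p (n - k) * u $ e k
     + (if k = 1 then of_real (deriv f (Re (p $ e 1))) * u $ e 1 else 0))"
    by (rule sum.cong) (auto simp: grad_def algebra_simps)
  also have "\<dots> = (\<Sum>k\<in>{1..<n}. 2 * y p (n - k) * u $ e k) + of_real (deriv f (Re (p $ e 1))) * u $ e 1"
    using n by (simp add: sum.distrib)
  finally show ?thesis
    unfolding graph_fun_derivative_identity grad_dot_def by (simp add: grad_def)
qed

lemma graph_fun_deriv: "(graph_fun has_derivative (\<lambda>u. Re (grad_dot p u))) (at p)"
proof -
  have "(graph_fun has_derivative (\<lambda>u. deriv f (Re (p $ e 1)) * Re (u $ e 1) +
     Re (\<Sum>k\<in>{1..<n}. vre p $ e (n - k) * dy p (vre u) k + vre u $ e (n - k) * y p k))) (at p)"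
    unfolding graph_fun_def[abs_def]
    by (intro has_derivative_add deriv_f_comp[OF f] bounded_linear.has_derivative[OF bounded_linear_Re]
        has_derivative_sum has_derivative_mult y_deriv bounded_linear_imp_has_derivative[OF bounded_linear_vre_nth])
  moreover have "deriv f (Re (p $ e 1)) * Re (u $ e 1) +
     Re (\<Sum>k\<in>{1..<n}. vre p $ e (n - k) * dy p (vre u) k + vre u $ e (n - k) * y p k) = Re (grad_dot p (vre u))" for u
    unfolding grad_dot_eq by simp
  moreover have "Re (grad_dot p (vre u)) = Re (grad_dot p u)" for u
  proof -
    have "Im (grad p k) = 0" for k using grad_real[of p k] by (simp add: complex_eq_iff)
    then show ?thesis by (simp add: grad_dot_def)
  qed
  ultimately show ?thesis by simp
qed

text \<open>Twice the (1,0) part of the differential of the defining function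
  \<open>Re (p $ e 0) - graph_fun p\<close>.\<close>

definition \<nu> :: "complex ^ 'i \<Rightarrow> complex ^ 'i" where
  "\<nu> p = coords (\<lambda>k. if k = 0 then 1 else - grad p k)"

definition d\<nu> :: "complex ^ 'i \<Rightarrow> complex ^ 'i \<Rightarrow> complex ^ 'i" where
  "d\<nu> p u = coords (\<lambda>k. if k = 0 then 0 else - dgrad p u k)"

lemma vdot_nu: "vdot (\<nu> p) u = u $ e 0 - grad_dot p u"
  using n by (simp add: vdot_e \<nu>_def grad_dot_def sum_negf)

lemma vdot_dnu: "vdot (d\<nu> p u) a = - ((\<Sum>k\<in>{1..<n}. dgrad p u k * a $ e k) + dgrad p u n * a $ e n)"
  using n by (simp add: vdot_e d\<nu>_def sum_negf)

lemma y_axis: "k < n \<Longrightarrow> y (p + axis (e 0) c) k = y p k"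
  by (induction k) (use n in \<open>auto simp: axis_def\<close>)

lemma tangent_hypersurface:
  assumes "q \<in> M"
  shows "tangent_space M q = {u. Re (vdot (\<nu> q) u) = 0}"
proof -
  have "graph_fun (p + axis (e 0) c) = graph_fun p" for p c
  proof -
    have x: "vre (p + axis (e 0) c) $ e k = vre p $ e k" if "0 < k" "k \<le> n" for k
      using that by (simp add: axis_def)
    have "Re ((p + axis (e 0) c) $ e 1) = Re (p $ e 1)" using n by (simp add: axis_def)
    moreover have "(\<Sum>k\<in>{1..<n}. vre (p + axis (e 0) c) $ e (n - k) * y (p + axis (e 0) c) k)
        = (\<Sum>k\<in>{1..<n}. vre p $ e (n - k) * y p k)"
      by (rule sum.cong) (simp_all add: x y_axis del: vre_nth)
    ultimately show ?thesis unfolding graph_fun_def by presburger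
  qed
  with assms have "tangent_space M q = {u. Re (u $ e 0) = Re (grad_dot q u)}"
    unfolding hypersurface_eq using graph_fun_deriv by (intro tangent_space_graph)
  then show ?thesis by (simp add: vdot_nu)
qed

section \<open>Coordinates on H and the kernel direction\<close>

text \<open>Coordinate 0 is solved from \<open>vdot (\<nu> p) u = 0\<close>, so coordinates 1 to n
  are free parameters of H; \<open>vec_eqI_nu\<close> is the matching uniqueness.\<close>

definition lift :: "complex ^ 'i \<Rightarrow> (nat \<Rightarrow> complex) \<Rightarrow> complex ^ 'i" where
  "lift p h = coords (\<lambda>k. if k = 0 then (\<Sum>k\<in>{1..<n}. grad p k * h k) + grad p n * h n else h k)"

lemma lift_nth [simp]: "\<lbrakk>1 \<le> k; k \<le> n\<rbrakk> \<Longrightarrow> lift p h $ e k = h k"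
  by (simp add: lift_def)

lemma lift_0: "lift p h $ e 0 = (\<Sum>k\<in>{1..<n}. grad p k * h k) + grad p n * h n"
  by (simp add: lift_def)

lemma vdot_nu_lift [simp]: "vdot (\<nu> p) (lift p h) = 0"
  unfolding vdot_nu grad_dot_def using n by (simp add: lift_0)

lemma vec_eqI_nu:
  assumes "vdot (\<nu> p) u = 0" "vdot (\<nu> p) v = 0" and *: "\<And>k. \<lbrakk>1 \<le> k; k \<le> n\<rbrakk> \<Longrightarrow> u $ e k = v $ e k"
  shows "u = v"
proof (rule vec_eqI)
  fix k assume k: "k \<le> n"
  have "grad_dot p u = grad_dot p v"
    using n by (simp add: grad_dot_def *)
  then show "u $ e k = v $ e k"
    using assms k by (cases "k = 0") (auto simp: vdot_nu)
qed

definition w :: "complex ^ 'i \<Rightarrow> complex ^ 'i" where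
  "w p = lift p (\<lambda>k. if k = n then 1 else - y p (k - 1))"

definition dw :: "complex ^ 'i \<Rightarrow> complex ^ 'i \<Rightarrow> complex ^ 'i" where
  "dw p u = lift p (\<lambda>k. if k = n then 0 else - dy p u (k - 1))"

lemma w_nth: "\<lbrakk>1 \<le> k; k \<le> n\<rbrakk> \<Longrightarrow> w p $ e k = (if k = n then 1 else - y p (k - 1))"
  by (simp add: w_def)

text \<open>The term with the second derivative of \<open>f\<close> drops out since
  \<open>w p $ e 1 = - y p 0 = 0\<close>. The remaining sum is - 2 times the convolution of
  \<open>dy\<close> with \<open>y\<close>, and the last coordinate, where \<open>w\<close> is 1,
  contributes the same with + 2.\<close>

lemma dgrad_w: "(\<Sum>k\<in>{1..<n}. dgrad p u k * w p $ e k) + dgrad p u n * w p $ e n = 0"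
proof -
  have "(\<Sum>k\<in>{1..<n}. dgrad p u k * w p $ e k) = (\<Sum>k\<in>{1..<n}. - (2 * (dy p u (n - k) * y p (k - 1))))"
    by (rule sum.cong) (auto simp: dgrad_def w_nth)
  also have "\<dots> = - (2 * (\<Sum>k\<in>{1..<n}. dy p u (n - k) * y p (k - 1)))"
    by (simp add: sum_negf sum_distrib_left)
  also have "(\<Sum>k\<in>{1..<n}. dy p u (n - k) * y p (k - 1)) = (\<Sum>k\<in>{1..<n}. dy p u k * y p (n - Suc k))"
    by (subst sum_reflect[symmetric]) (auto intro!: sum.cong)
  also have "\<dots> = (\<Sum>k<n. dy p u k * y p (n - Suc k))"
    by (simp add: sum_lessThan_eq_from_1)
  finally show ?thesis using n by (simp add: w_nth dgrad_def)
qed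

text \<open>Coordinate 0 of \<open>w\<close> pairs the gradient with \<open>w\<close>. The Leibniz
  rule adds the derivative of the gradient paired with \<open>w\<close>, which is 0 by
  \<open>dgrad_w\<close>; what remains is again a \<open>lift\<close> at the same point.\<close>

lemma w_deriv: "(w has_derivative (\<lambda>u. dw p (vre u))) (at p within S)"
proof -
  have y': "((\<lambda>p. if k = n then 1 else - y p (k - 1)) has_derivative
     (\<lambda>u. if k = n then 0 else - dy p (vre u) (k - 1))) (at p within S)" for k
    by (cases "k = n") (simp_all add: has_derivative_minus y_deriv)
  let ?h = "\<lambda>p k. if k = n then 1 else - y p (k - 1)"
  let ?h' = "\<lambda>u k. if k = n then 0 else - dy p (vre u) (k - 1)"
  have 1: "((\<lambda>p. (\<Sum>k\<in>{1..<n}. grad p k * ?h p k) + grad p n * ?h p n) has_derivative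
     (\<lambda>u. (\<Sum>k\<in>{1..<n}. grad p k * ?h' u k + dgrad p (vre u) k * ?h p k) +
        (grad p n * ?h' u n + dgrad p (vre u) n * ?h p n))) (at p within S)"
    by (intro has_derivative_add has_derivative_sum has_derivative_mult grad_deriv y')
  have 2: "(\<Sum>k\<in>{1..<n}. dgrad p (vre u) k * ?h p k) + dgrad p (vre u) n * ?h p n = 0" for u
  proof -
    have "(\<Sum>k\<in>{1..<n}. dgrad p (vre u) k * ?h p k) = (\<Sum>k\<in>{1..<n}. dgrad p (vre u) k * w p $ e k)"
      by (rule sum.cong) (auto simp: w_nth)
    moreover have "?h p n = w p $ e n" using n by (simp add: w_nth)
    ultimately show ?thesis using dgrad_w[of p "vre u"] by simp
  qed
  have 3: "a + b + (c + d) = a + c" if "b + d = 0" for a b c d :: complex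
    using that by (simp add: add_eq_0_iff algebra_simps)
  have 4: "(\<Sum>k\<in>{1..<n}. grad p k * ?h' u k + dgrad p (vre u) k * ?h p k) +
        (grad p n * ?h' u n + dgrad p (vre u) n * ?h p n)
      = (\<Sum>k\<in>{1..<n}. grad p k * ?h' u k) + grad p n * ?h' u n" for u
    unfolding sum.distrib by (rule 3[OF 2])
  have 0: "((\<lambda>p. (\<Sum>k\<in>{1..<n}. grad p k * ?h p k) + grad p n * ?h p n) has_derivative
     (\<lambda>u. (\<Sum>k\<in>{1..<n}. grad p k * ?h' u k) + grad p n * ?h' u n)) (at p within S)"
    using 1 unfolding 4 .
  show ?thesis
    unfolding w_def[abs_def] dw_def lift_def
  proof (rule has_derivative_coords)
    fix k
    show "((\<lambda>p. if k = 0 then (\<Sum>k\<in>{1..<n}. grad p k * ?h p k) + grad p n * ?h p n else ?h p k)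
      has_derivative (\<lambda>u. if k = 0 then (\<Sum>k\<in>{1..<n}. grad p k * ?h' u k) + grad p n * ?h' u n else ?h' u k))
      (at p within S)"
      using 0 y'[of k] by (cases "k = 0") (simp_all only: refl if_True if_False)
  qed
qed

lemma nu_deriv: "(\<nu> has_derivative (\<lambda>u. d\<nu> p (vre u))) (at p within S)"
  unfolding \<nu>_def[abs_def] d\<nu>_def
proof (rule has_derivative_coords)
  fix k
  show "((\<lambda>p. if k = 0 then 1 else - grad p k) has_derivative
      (\<lambda>u. if k = 0 then 0 else - dgrad p (vre u) k)) (at p within S)"
    by (cases "k = 0") (simp_all add: has_derivative_minus grad_deriv)
qed

text \<open>In the recursion \<open>w p $ e (Suc k) = - y p k\<close> cancels
  \<open>w p $ e n * y p k\<close>: these \<open>y\<close> are constant along the leaf.\<close>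

lemma dy_w: "k < n \<Longrightarrow> dy p (w p) k = 0"
  by (induction k) (auto simp: w_nth)

lemma dw_add: "dw p (u + v) = dw p u + dw p v"
  and dw_scale: "dw p (c *s u) = c *s dw p u"
  by (rule vec_eqI_nu[of p]; simp add: vdot_simps dw_def dy_add dy_scale)+

section \<open>Verification that \<open>w\<close> spans the Levi kernel\<close>

sublocale tube_form_kernel M "e 0" \<nu> d\<nu> "e n" w dw
proof (intro tube_form_kernel.intro tube_form.intro tube_form_kernel_axioms.intro)
  fix q assume q: "q \<in> M"
  show "tangent_space M q = {u. Re (vdot (\<nu> q) u) = 0}"
    using q by (rule tangent_hypersurface)
  show "(\<nu> has_derivative (\<lambda>u. d\<nu> q (vre u))) (at q within M)"
    by (rule nu_deriv)
  show "(w has_derivative (\<lambda>u. dw q (vre u))) (at q within M)"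
    by (rule w_deriv)
  fix a assume a: "vdot (\<nu> q) a = 0" "\<And>b. vdot (\<nu> q) b = 0 \<Longrightarrow> vdot (d\<nu> q (vcnj b)) a = 0"
  \<comment> \<open>Subtracting the multiple of \<open>w\<close> with the same last coordinate
    leaves only the Hessian block in coordinates 1 to n - 1.\<close>
  define a' where "a' = a - a $ e n *s w q"
  have a'n: "a' $ e n = 0" using n by (simp add: a'_def w_nth)
  have nu_a': "vdot (\<nu> q) a' = 0" by (simp add: a'_def vdot_simps a w_def)
  have hess_a': "(\<Sum>k\<in>{1..<n}. dgrad q (vcnj b) k * a' $ e k) = 0" if "vdot (\<nu> q) b = 0" for b
  proof -
    have "vdot (d\<nu> q (vcnj b)) a' = 0"
      using a(2)[OF that] dgrad_w[of q "vcnj b"] by (simp add: a'_def vdot_simps vdot_dnu)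
    then show ?thesis by (simp add: vdot_dnu a'n)
  qed
  let ?c = "of_real (deriv (deriv f) (Re (q $ e 1)))"
  have eq: "2 * a' $ e (n - j) + (if j = 1 then ?c * a' $ e 1 else 0) = 0" if j: "j \<in> {1..<n}" for j
  proof -
    \<comment> \<open>A test vector for which \<open>dy\<close> below n is the unit vector at
      \<open>j\<close>: the entry \<open>- vre q $ e n\<close> cancels what the recursion carries to
      \<open>Suc j\<close>, and the guard \<open>k < n\<close> keeps the last coordinate 0. These
      entries are real, so conjugation does not alter them.\<close>
    define b where "b = lift q (\<lambda>k. if k = j then 1 else if k = Suc j \<and> k < n then - vre q $ e n else 0)"
    have b: "vdot (\<nu> q) b = 0" by (simp add: b_def)
    have bk: "vcnj b $ e k = (if k = j then 1 else if k = Suc j \<and> k < n then - vre q $ e n else 0)"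
      if "1 \<le> k" "k \<le> n" for k
      using that by (simp add: b_def)
    have dy: "dy q (vcnj b) k = (if k = j then 1 else 0)" if "k < n" for k
      using that
    proof (induction k)
      case 0
      then show ?case using j by simp
    next
      case (Suc k)
      have "vcnj b $ e n = 0" using j n by (subst bk) auto
      moreover have "vcnj b $ e (Suc k) = (if Suc k = j then 1 else if k = j then - vre q $ e n else 0)"
        using Suc.prems by (subst bk) auto
      ultimately show ?case using Suc by (simp del: vcnj_nth vre_nth)
    qed
    have b1: "vcnj b $ e 1 = (if j = 1 then 1 else 0)"
      using j n by (subst bk) auto
    \<comment> \<open>The entry 2 sits on the antidiagonal at \<open>n - j\<close>; the second
      derivative of \<open>f\<close> enters only for \<open>j = 1\<close>.\<close>
    have "dgrad q (vcnj b) k * a' $ e k = (if k = n - j then 2 * a' $ e k else 0)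
       + (if k = 1 then (if j = 1 then ?c * a' $ e 1 else 0) else 0)" if "k \<in> {1..<n}" for k
      using that j by (auto simp: dgrad_def dy b1 algebra_simps simp del: vcnj_nth One_nat_def)
    then have "(\<Sum>k\<in>{1..<n}. dgrad q (vcnj b) k * a' $ e k)
       = (\<Sum>k\<in>{1..<n}. (if k = n - j then 2 * a' $ e k else 0)
       + (if k = 1 then (if j = 1 then ?c * a' $ e 1 else 0) else 0))"
      by (rule sum.cong[OF refl])
    also have "\<dots> = 2 * a' $ e (n - j) + (if j = 1 then ?c * a' $ e 1 else 0)"
    proof -
      have "n - j \<in> {1..<n}" using j by auto
      then show ?thesis using n by (simp add: sum.distrib)
    qed
    finally show ?thesis using hess_a'[OF b] by simp
  qed
  \<comment> \<open>The case \<open>j = n - 1\<close> comes first: since n > 2 it differs from 1, so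
    no second derivative of \<open>f\<close> occurs. Then \<open>a' $ e 1 = 0\<close> removes that
    term from the case \<open>j = 1\<close> too.\<close>
  have a'1: "a' $ e 1 = 0" using eq[of "n - 1"] n by (simp add: Suc_le_eq split: if_splits)
  have "a' $ e k = 0" if "k \<in> {1..<n}" for k
    using eq[of "n - k"] that a'1 by (auto simp: Suc_le_eq split: if_splits)
  then have "a' = 0"
    using a'n nu_a' by (intro vec_eqI_nu[of q]) (auto simp: vdot_simps le_less)
  then show "\<exists>c. a = c *s w q" by (intro exI[of _ "a $ e n"]) (simp add: a'_def)
next
  fix q u
  show "Vector_Spaces.linear (*s) (*s) (d\<nu> q)"
    unfolding Vector_Spaces.linear_iff
    by (auto intro!: vec.vector_space_axioms vec_eqI simp: d\<nu>_def dgrad_add dgrad_scale)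
  show "Vector_Spaces.linear (*s) (*s) (dw q)"
    unfolding Vector_Spaces.linear_iff
    by (auto intro!: vec.vector_space_axioms simp: dw_add dw_scale)
  show "\<nu> q $ e 0 = 1" by (simp add: \<nu>_def)
  show "w q $ e n = 1" using n by (simp add: w_nth)
  show nu_w: "vdot (\<nu> q) (w q) = 0" by (simp add: w_def)
  show "vdot (\<nu> q) (dw q u) = 0" by (simp add: dw_def)
  show "vcnj (w q) = w q"
  proof (rule vec_eqI)
    fix k assume "k \<le> n"
    then show "vcnj (w q) $ e k = w q $ e k"
      by (simp add: w_def lift_def y_real grad_real)
  qed
  show "dw q (w q) = 0"
    by (rule vec_eqI_nu[of q]) (auto simp: dw_def vdot_simps dy_w)
  show "d\<nu> q (w q) = 0"
    by (rule vec_eqI) (use n in \<open>auto simp: d\<nu>_def dgrad_def dy_w w_nth\<close>)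
  show "vdot (d\<nu> q u) (w q) = 0"
    unfolding vdot_dnu dgrad_w by simp
qed

section \<open>The adjoint operator as a strictly triangular matrix\<close>

lemma adjoint_generator_nth:
  assumes "1 \<le> k" "k < n"
  shows "adjoint_generator q b $ e k = dy q (vcnj b) (k - 1)"
  using assms by (simp add: adjoint_generator_def dw_def)

lemma adjoint_generator_n: "adjoint_generator q b $ e n = 0"
  using n by (simp add: adjoint_generator_def dw_def)

text \<open>The last coordinate is 0 on the left and \<open>c\<close> on the right, so the image of
  the generator meets the kernel line only in 0.\<close>

lemma adjoint_generator_eq_w:
  assumes "adjoint_generator q b = c *s w q"
  shows "adjoint_generator q b = 0"
proof -
  have "c = 0" using arg_cong[OF assms, of "\<lambda>v. v $ e n"] n by (simp add: adjoint_generator_n w_nth)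
  then show ?thesis using assms by simp
qed

lemma dy_eq_0:
  assumes "u $ e n = 0" "\<And>j. \<lbrakk>1 \<le> j; j \<le> k\<rbrakk> \<Longrightarrow> u $ e j = 0"
  shows "dy q u k = 0"
  using assms by (induction k) auto

text \<open>For k < n, coordinate k of an image involves only coordinates below k and the last one,
  and the last one is 0 after one application. Each application thus clears one more coordinate;
  coordinate 0 then follows from \<open>\<nu>\<close>.\<close>

lemma adjoint_generator_nilpotent: "(adjoint_generator q ^^ n) b = 0"
proof -
  have 1: "(adjoint_generator q ^^ Suc m) b $ e n = 0 \<and>
    (\<forall>k. 1 \<le> k \<and> k < n \<and> k \<le> Suc m \<longrightarrow> (adjoint_generator q ^^ Suc m) b $ e k = 0)" for m
  proof (induction m)
    case 0
    then show ?case by (auto simp: adjoint_generator_n adjoint_generator_nth le_Suc_eq)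
  next
    case (Suc m)
    let ?v = "(adjoint_generator q ^^ Suc m) b"
    have "adjoint_generator q ?v $ e k = 0" if "1 \<le> k" "k < n" "k \<le> Suc (Suc m)" for k
      unfolding adjoint_generator_nth[OF that(1,2)]
      by (rule dy_eq_0) (use Suc that in auto)
    then show ?case by (simp add: adjoint_generator_n)
  qed
  obtain m where m: "n = Suc m" using n by (cases n) auto
  show ?thesis
    using 1[of m] vdot_adjoint_generator[of q "(adjoint_generator q ^^ m) b"]
    by (intro vec_eqI_nu[of q]) (auto simp: m vdot_simps le_less)
qed

text \<open>Coordinate k < n of an image reads \<open>dy\<close> at k - 1, which never reaches
  coordinate n - 1; this is why \<open>z\<close> is killed.\<close>

lemma adjoint_generator_kernel:
  fixes q
  defines "z \<equiv> lift q (\<lambda>k. if k = n - 1 then 1 else 0)"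
  shows "vdot (\<nu> q) z = 0" "adjoint_generator q z = 0" "\<nexists>c. z = c *s w q"
    and "\<lbrakk>vdot (\<nu> q) b = 0; adjoint_generator q b = c *s w q\<rbrakk> \<Longrightarrow> \<exists>d c. b = d *s z + c *s w q"
proof -
  show 1: "vdot (\<nu> q) z = 0" by (simp add: z_def)
  have zn: "z $ e n = 0" using n by (simp add: z_def)
  have zn1: "z $ e (n - 1) = 1" using n by (simp add: z_def)
  show "adjoint_generator q z = 0"
  proof (rule vec_eqI_nu[of q])
    fix k assume k: "1 \<le> k" "k \<le> n"
    show "adjoint_generator q z $ e k = 0 $ e k"
    proof (cases "k = n")
      case False
      then have "dy q (vcnj z) (k - 1) = 0"
        using k zn by (intro dy_eq_0) (auto simp: z_def)
      then show ?thesis using False k by (simp add: adjoint_generator_nth)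
    qed (simp add: adjoint_generator_n)
  qed (simp_all add: vdot_adjoint_generator vdot_simps)
  show "\<nexists>c. z = c *s w q"
  proof
    assume "\<exists>c. z = c *s w q"
    then obtain c where c: "z = c *s w q" ..
    then have "c = 0" using zn n by (simp add: w_nth)
    then show False using zn1 c by simp
  qed
  assume b: "vdot (\<nu> q) b = 0" "adjoint_generator q b = c *s w q"
  \<comment> \<open>Coordinate \<open>Suc k\<close> of the image is \<open>dy\<close> at
    \<open>k\<close>, hence the bound \<open>n - 1\<close>.\<close>
  have dyb: "dy q (vcnj b) k = 0" if "k < n - 1" for k
    using adjoint_generator_eq_w[OF b(2)] adjoint_generator_nth[of "Suc k" q b] that by simp
  define b' where "b' = b - b $ e n *s w q"
  have "b = b' + b $ e n *s w q" by (simp add: b'_def)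
  then have "vcnj b = vcnj b' + cnj (b $ e n) *s w q"
    by (metis vcnj_add vcnj_scale w_real)
  then have dyb': "dy q (vcnj b') k = 0" if "k < n - 1" for k
    using dyb[OF that] that by (simp add: dy_add dy_scale dy_w)
  have b'n: "b' $ e n = 0" using n by (simp add: b'_def w_nth)
  \<comment> \<open>With last coordinate 0, two consecutive values of \<open>dy\<close> determine
    coordinate k, so it vanishes; only coordinate n - 1 stays free.\<close>
  have b'k: "b' $ e k = 0" if "1 \<le> k" "k < n - 1" for k
    using dyb'[of k] dyb'[of "k - 1"] that b'n by (cases k) auto
  have "b' = b' $ e (n - 1) *s z"
  proof (rule vec_eqI_nu[of q])
    fix k assume k: "1 \<le> k" "k \<le> n"
    then consider "k < n - 1" | "k = n - 1" | "k = n" by linarith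
    then show "b' $ e k = (b' $ e (n - 1) *s z) $ e k"
      using k n b'k b'n by cases (auto simp: z_def)
  qed (simp_all add: b'_def vdot_simps b 1 nu_w)
  moreover have "b = b' + b $ e n *s w q" by (simp add: b'_def)
  ultimately have "b = b' $ e (n - 1) *s z + b $ e n *s w q" by metis
  then show "\<exists>d c. b = d *s z + c *s w q" by blast
qed

text \<open>A subdiagonal entry: the first coordinate is carried to the second, which lies below the
  last because n > 2.\<close>

lemma adjoint_generator_nonzero: "\<nexists>c. adjoint_generator q (lift q (\<lambda>k. if k = 1 then 1 else 0)) = c *s w q"
proof
  let ?b = "lift q (\<lambda>k. if k = 1 then 1 else 0)"
  assume "\<exists>c. adjoint_generator q ?b = c *s w q"
  then have "adjoint_generator q ?b $ e 2 = 0" using adjoint_generator_eq_w by fastforce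
  moreover have "adjoint_generator q ?b $ e 2 = 1"
    using n by (simp add: adjoint_generator_nth)
  ultimately show False by simp
qed

end

theorem theorem1p1:
  fixes n :: nat and f :: "real \<Rightarrow> real" and e :: "nat \<Rightarrow> 'i::finite"
  assumes "n > 2"
    and "bij_betw e {0..n} (UNIV :: 'i set)"
    and "\<forall>x. f differentiable (at x)"
    and "\<forall>x. deriv f differentiable (at x)"
  shows "uniformly_two_nondegenerate (hypersurface n e f)
    \<and> (\<forall>q \<in> hypersurface n e f. cplxn.dim (levi_kernel (hypersurface n e f) q) = 1)
    \<and> (\<forall>q \<in> hypersurface n e f.
         let H = hol_tangent_space (hypersurface n e f) q;
             K = levi_kernel (hypersurface n e f) q
         in \<exists>A \<in> quotient_space H K \<rightarrow> quotient_space H K.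
              nilpotent_operator H K A
              \<and> one_dimensional H K (eigenspace H K A 0)
              \<and> levi_adjoint (hypersurface n e f) q ` K = operator_span H K A)"
proof -
  interpret hypersurface_data n f e
    using assms by unfold_locales
  have "two_nondegenerate_at M q" if "q \<in> M" for q
    unfolding two_nondegenerate_at_def
    using inj_on_levi_adjoint[OF that vdot_nu_lift adjoint_generator_nonzero] dim_levi_kernel
    by (intro conjI exI[of _ 1]) simp_all
  moreover have "\<exists>A \<in> quotient_space (hol_tangent_space M q) (levi_kernel M q)
        \<rightarrow> quotient_space (hol_tangent_space M q) (levi_kernel M q).
      nilpotent_operator (hol_tangent_space M q) (levi_kernel M q) A
      \<and> one_dimensional (hol_tangent_space M q) (levi_kernel M q)
        (eigenspace (hol_tangent_space M q) (levi_kernel M q) A 0)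
      \<and> levi_adjoint M q ` levi_kernel M q
        = operator_span (hol_tangent_space M q) (levi_kernel M q) A" if "q \<in> M" for q
    by (rule nilpotent_adjoint_operator[OF that adjoint_generator_nilpotent
          adjoint_generator_kernel(1-3)]) (rule adjoint_generator_kernel(4))
  ultimately show ?thesis
    unfolding uniformly_two_nondegenerate_def Let_def using dim_levi_kernel by simp
qed

end
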